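(* Let $n\ge 5$ and let $G_n=K(n,2)$ be the Kneser graph. Then: (i) $Z_0(G_n)=\binom{n}{2}-6$ for $n\in\{5,6,7\}$; (ii) $Z_1(G_n)=\binom{n}{2}-5$ for $n\in\{5,6\}$; (iii) $Z_1(G_7)=15$; (iv) for $n\ge 8$ and $q\in\{0,1,2\}$, $Z_q(G_n)\in\left\{\binom{n-1}{2}-1,\ \binom{n-1}{2}\right\}$.
   Context: The Kneser graph $K(n,2)$ has as vertices the 2-element subsets of $\{1,\dots,n\}$, two vertices being adjacent if and only if they are disjoint. Colour change rule (CCR): if a coloured vertex has exactly one uncoloured neighbour, that neighbour becomes coloured. $Z_q$-game ($q\ge 0$ an integer): initially all vertices of $G=(V,E)$ are uncoloured. The player repeatedly applies one of the following until all vertices are coloured: (1) for one token, colour any uncoloured vertex; (2) at no cost, apply the CCR on $G$; (3) if $B$ is the current set of coloured vertices and $W_1,\dots,W_k$ are the vertex sets of the components of $G[V\setminus B]$ with $k\ge q+1$, the player selects at least $q+1$ of the $W_i$'s and announces them to an oracle, the oracle returns a nonempty subset $\{W_{i_1},\dots,W_{i_\ell}\}$ of the selected ones, and at no cost the player can apply the CCR on $G[B\cup W_{i_1}\cup\cdots\cup W_{i_\ell}]$. $Z_q(G)$ is the minimum number of tokens needed to guarantee that all vertices can be coloured regardless of how the oracle responds. *)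

theory Defs
  imports Main
begin

text \<open>Simple graphs are given by a vertex set and a (symmetric, irreflexive) adjacency relation.\<close>

record 'a ugraph =
  verts :: "'a set"
  adj :: "('a \<times> 'a) set"

definition induced :: "'a ugraph \<Rightarrow> 'a set \<Rightarrow> 'a ugraph" where
  "induced G U = \<lparr>verts = verts G \<inter> U, adj = adj G \<inter> U \<times> U\<rparr>"

text \<open>Vertex sets of the connected components: the classes of the relation
  ``joined by a walk'' on the vertex set.\<close>

definition components :: "'a ugraph \<Rightarrow> 'a set set" where
  "components G = verts G // (adj G \<inter> verts G \<times> verts G)\<^sup>*"

definition kneser :: "nat \<Rightarrow> nat \<Rightarrow> nat set ugraph" where
  "kneser n r =
    (let V = {A. A \<subseteq> {1..n} \<and> card A = r}
     in \<lparr>verts = V, adj = {(A, A'). A \<in> V \<and> A' \<in> V \<and> A \<inter> A' = {}}\<rparr>)"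

text \<open>One application of the colour change rule on \<open>H\<close>, taking the set of coloured
  vertices from \<open>B\<close> to \<open>B'\<close>.\<close>

definition ccr :: "'a ugraph \<Rightarrow> 'a set \<Rightarrow> 'a set \<Rightarrow> bool" where
  "ccr H B B' \<longleftrightarrow>
    (\<exists>u \<in> verts H \<inter> B. \<exists>w. {x \<in> verts H - B. (u, x) \<in> adj H} = {w} \<and> B' = insert w B)"

text \<open>\<open>can_win q G k B\<close>: in the \<open>Z\<^sub>q\<close>-game on \<open>G\<close>, from the position in which \<open>B\<close> is the set of
  coloured vertices, the player can guarantee, spending at most \<open>k\<close> further tokens and whatever
  the oracle answers, that all vertices get coloured.  The least fixed point expresses that every
  play according to the player's strategy ends after finitely many moves.  In the oracle move,
  \<open>S\<close> is the player's selection and \<open>T\<close> the answer; after learning \<open>T\<close> the player either makes one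
  application of the colour change rule on \<open>G[B \<union> \<Union>T]\<close> or declines (reflexive closure).\<close>

inductive can_win :: "nat \<Rightarrow> 'a ugraph \<Rightarrow> nat \<Rightarrow> 'a set \<Rightarrow> bool" for q G where
  finished: "verts G \<subseteq> B \<Longrightarrow> can_win q G k B"
| token: "\<lbrakk>v \<in> verts G - B; can_win q G k (insert v B)\<rbrakk> \<Longrightarrow> can_win q G (Suc k) B"
| change: "\<lbrakk>ccr G B B'; can_win q G k B'\<rbrakk> \<Longrightarrow> can_win q G k B"
| oracle_move:
    "\<lbrakk>S \<subseteq> components (induced G (verts G - B)); card S \<ge> q + 1;
      \<And>T. \<lbrakk>T \<subseteq> S; T \<noteq> {}\<rbrakk> \<Longrightarrow>
        \<exists>B'. (ccr (induced G (B \<union> \<Union>T)))\<^sup>=\<^sup>= B B' \<and> can_win q G k B'\<rbrakk>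
     \<Longrightarrow> can_win q G k B"

definition Z_game :: "nat \<Rightarrow> 'a ugraph \<Rightarrow> nat" where
  "Z_game q G = (LEAST k. can_win q G k {})"

text \<open>On finite graphs the minimum is over a nonempty set, hence attained.\<close>

lemma can_win_card:
  assumes "finite (verts G)"
  shows "can_win q G (card (verts G - B)) B"
proof (induction "card (verts G - B)" arbitrary: B)
  case 0
  then have "verts G \<subseteq> B" using assms by auto
  then show ?case by (rule can_win.finished)
next
  case (Suc m)
  then obtain v where v: "v \<in> verts G - B"
    by (metis card.empty ex_in_conv nat.distinct(1))
  have "verts G - insert v B = (verts G - B) - {v}" by blast
  then have m: "m = card (verts G - insert v B)"
    using Suc.hyps(2) v assms by simp
  have "can_win q G m (insert v B)" using Suc.hyps(1)[OF m] m by simp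
  then show ?case using can_win.token[OF v] Suc.hyps(2) by metis
qed

lemma can_win_Z_game:
  assumes "finite (verts G)"
  shows "can_win q G (Z_game q G) {}"
  unfolding Z_game_def using can_win_card[OF assms] by (rule LeastI[where P = "\<lambda>k. can_win q G k {}"])

end

theory Submission
  imports Defs
begin

text \<open>A vertex of $K(n,2)$ is an edge of the complete graph on $\{1,\dots,n\}$, so the uncoloured
  vertices form a graph \<open>W\<close> on $\{1,\dots,n\}$.

  Lower bounds: a fort is a set of vertices into which no move can make progress as long as it is
  entirely uncoloured; hence \<open>k\<close> tokens suffice only if some \<open>k\<close> vertices meet every fort.  If \<open>W\<close>
  has at least seven edges and is not itself a fort, then all of its edges but one meet a fixed pair
  \<open>x\<close>, \<open>y\<close>, and when \<open>W\<close> is large the double star formed by the edges at \<open>x\<close> and \<open>y\<close>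
  contains a fort.  For \<open>q = 1\<close> every 4-cycle acts as a fort as well.

  Upper bounds: the player leaves uncoloured a star with \<open>n - 1\<close> edges (\<open>q \<le> 2\<close>), a complete graph
  on four vertices (\<open>q = 0\<close>), or a 5-cycle (\<open>n = 5\<close>).\<close>

section \<open>Forts and the game on arbitrary graphs\<close>

lemma verts_induced [simp]: "verts (induced G U) = verts G \<inter> U"
  by (simp add: induced_def)

lemma adj_induced [simp]: "adj (induced G U) = adj G \<inter> U \<times> U"
  by (simp add: induced_def)

text \<open>For symmetric adjacency these are exactly the unions of vertex sets of components of
  \<open>G[F]\<close>, described without walks. This form passes easily from a set to its
  subsets.\<close>

definition separated :: "'a ugraph \<Rightarrow> 'a set \<Rightarrow> 'a set \<Rightarrow> bool" where
  "separated G F C \<longleftrightarrow> C \<subseteq> F \<and> (\<forall>c\<in>C. \<forall>d\<in>F - C. (c, d) \<notin> adj G)"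

text \<open>Quantifying over all separated sets \<open>C\<close>, not only over the components of \<open>G[F]\<close>, makes a fort
  resist every answer of the oracle, so one notion serves all \<open>q\<close>.\<close>

definition fort :: "'a ugraph \<Rightarrow> 'a set \<Rightarrow> bool" where
  "fort G F \<longleftrightarrow> F \<noteq> {} \<and> F \<subseteq> verts G \<and>
    (\<forall>C. separated G F C \<longrightarrow> (\<forall>u\<in>verts G - F. \<forall>w. {x \<in> C. (u, x) \<in> adj G} \<noteq> {w}))"

section \<open>Components of induced subgraphs and separated sets\<close>

lemma components_induced:
  assumes "W \<subseteq> verts G"
  shows "components (induced G W) = W // (adj G \<inter> W \<times> W)\<^sup>*"
proof -
  have "verts G \<inter> W = W" using assms by blast
  moreover have "adj G \<inter> W \<times> W \<inter> W \<times> W = adj G \<inter> W \<times> W" by blast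
  ultimately show ?thesis by (simp add: components_def)
qed

text \<open>A walk inside \<open>W\<close> that starts in \<open>C\<close> never leaves
  \<open>C\<close>, so a component touching \<open>C\<close> is swallowed by it.\<close>

lemma component_subset_separated:
  assumes "W \<subseteq> verts G" "sym (adj G)" "U \<in> components (induced G W)"
    and "separated G W C" "w \<in> U" "w \<in> C"
  shows "U \<subseteq> C"
proof -
  let ?R = "adj G \<inter> W \<times> W"
  have "sym ?R" using assms(2) by (auto simp: sym_def)
  then have s: "sym (?R\<^sup>*)" by (rule sym_rtrancl)
  obtain v where v: "v \<in> W" "U = ?R\<^sup>* `` {v}"
    using assms(3) unfolding components_induced[OF assms(1)] by (rule quotientE)
  show ?thesis
  proof
    fix z assume "z \<in> U"
    then have "(v, z) \<in> ?R\<^sup>*" "(v, w) \<in> ?R\<^sup>*" using v assms(5) by auto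
    then have "(w, z) \<in> ?R\<^sup>*" using s by (meson rtrancl_trans symD)
    then show "z \<in> C"
    proof (induction rule: rtrancl_induct)
      case (step c d)
      then show ?case using assms(4) unfolding separated_def by blast
    qed (rule assms(6))
  qed
qed

lemma component_separated:
  assumes "W \<subseteq> verts G" "U \<in> components (induced G W)"
  shows "separated G W U"
proof -
  let ?R = "adj G \<inter> W \<times> W"
  obtain v where v: "v \<in> W" "U = ?R\<^sup>* `` {v}"
    using assms(2) unfolding components_induced[OF assms(1)] by (rule quotientE)
  have "z \<in> W" if "(v, z) \<in> ?R\<^sup>*" for z
    using that by (induction rule: rtrancl_induct) (use v in auto)
  moreover have "(v, d) \<in> ?R\<^sup>*" if "(v, c) \<in> ?R\<^sup>*" "(c, d) \<in> adj G" "c \<in> W" "d \<in> W" for c d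
    using that by (meson IntI SigmaI rtrancl.rtrancl_into_rtrancl)
  ultimately show ?thesis unfolding separated_def v(2) by blast
qed

lemma component_nonempty:
  assumes "W \<subseteq> verts G" "U \<in> components (induced G W)"
  shows "U \<noteq> {}"
  using assms(2) unfolding components_induced[OF assms(1)] by (rule quotientE) blast

lemma obtain_component:
  assumes "W \<subseteq> verts G" "w \<in> W"
  obtains U where "U \<in> components (induced G W)" "w \<in> U"
proof
  show "(adj G \<inter> W \<times> W)\<^sup>* `` {w} \<in> components (induced G W)"
    using assms by (simp add: components_induced quotientI)
qed simp

lemma components_disjoint:
  assumes "W \<subseteq> verts G" "sym (adj G)"
    and "U \<in> components (induced G W)" "U' \<in> components (induced G W)" "w \<in> U" "w \<in> U'"
  shows "U = U'"
  using assms component_subset_separated component_separated by (metis subset_antisym)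

text \<open>If \<open>w\<close> had no neighbour in \<open>U\<close>, then \<open>{w}\<close> would
  be separated in \<open>W\<close> and would already be the whole component.\<close>

lemma component_neighbour:
  assumes "W \<subseteq> verts G" "sym (adj G)" "U \<in> components (induced G W)" "w \<in> U" "U \<noteq> {w}"
  shows "\<exists>w'\<in>U. (w, w') \<in> adj G"
proof (rule ccontr)
  assume no: "\<not> ?thesis"
  have sep: "separated G W U" by (rule component_separated[OF assms(1,3)])
  have "separated G W {w}"
    unfolding separated_def
  proof (intro conjI ballI)
    show "{w} \<subseteq> W" using sep assms(4) unfolding separated_def by blast
    fix c d assume "c \<in> {w}" "d \<in> W - {w}"
    then show "(c, d) \<notin> adj G" using no sep assms(4) unfolding separated_def by blast
  qed
  then have "U \<subseteq> {w}" by (rule component_subset_separated[OF assms(1-3) _ assms(4)]) simp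
  then show False using assms(4,5) by blast
qed

lemma separated_Union:
  assumes "\<And>U. U \<in> T \<Longrightarrow> separated G W U"
  shows "separated G W (\<Union>T)"
  using assms by (fastforce simp: separated_def)

section \<open>The hitting-set lower bound\<close>

text \<open>Separatedness survives restriction from \<open>W\<close> to \<open>F\<close>: if
  \<open>u\<close> saw only \<open>w\<close> in \<open>U\<close>, it would see only \<open>w\<close>
  in the separated part \<open>F \<inter> U\<close> of the fort.\<close>

lemma fort_not_forced:
  assumes "fort G F" "F \<subseteq> W" "separated G W U" "u \<in> verts G - W" "w \<in> F"
  shows "{x \<in> U. (u, x) \<in> adj G} \<noteq> {w}"
proof
  assume eq: "{x \<in> U. (u, x) \<in> adj G} = {w}"
  have "separated G F (F \<inter> U)" using assms by (auto simp: separated_def)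
  moreover have "{x \<in> F \<inter> U. (u, x) \<in> adj G} = {w}"
    using eq assms(5) by (auto simp: set_eq_iff)
  moreover have "u \<in> verts G - F" using assms(2,4) by blast
  ultimately show False using assms(1) unfolding fort_def by (meson)
qed

lemma ccrE:
  assumes "ccr H B B'"
  obtains u w where "u \<in> verts H \<inter> B" "{x \<in> verts H - B. (u, x) \<in> adj H} = {w}" "B' = insert w B"
  using assms unfolding ccr_def by (elim bexE exE conjE)

text \<open>Follow the play against an oracle that answers as in \<open>oracle_answer\<close> and
  let \<open>X\<close> collect the vertices paid for. No free move enters a member of the family
  that is still entirely uncoloured, so the first coloured vertex of each member lies in
  \<open>B\<close> or was bought. One answer has to protect all members at the same time.\<close>

lemma can_win_hitting_set:
  fixes G :: "'a ugraph" and \<F> :: "'a set set"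
  assumes "can_win q G k B"
    and ne: "\<And>F. F \<in> \<F> \<Longrightarrow> F \<noteq> {} \<and> F \<subseteq> verts G"
    and plain: "\<And>F W u w. \<lbrakk>F \<in> \<F>; F \<subseteq> W; W \<subseteq> verts G; u \<in> verts G - W; w \<in> F\<rbrakk>
      \<Longrightarrow> {x \<in> W. (u, x) \<in> adj G} \<noteq> {w}"
    and oracle_answer: "\<And>W S. \<lbrakk>W \<subseteq> verts G; S \<subseteq> components (induced G W); card S \<ge> q + 1\<rbrakk>
      \<Longrightarrow> \<exists>T\<subseteq>S. T \<noteq> {} \<and> (\<forall>F\<in>\<F>. F \<subseteq> W \<longrightarrow>
            (\<forall>u\<in>verts G - W. \<forall>w\<in>F. {x \<in> \<Union>T. (u, x) \<in> adj G} \<noteq> {w}))"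
  shows "\<exists>X. finite X \<and> card X \<le> k \<and> (\<forall>F\<in>\<F>. F \<inter> (B \<union> X) \<noteq> {})"
  using assms(1)
proof (induction rule: can_win.induct)
  case (finished B k)
  have "F \<inter> (B \<union> {}) \<noteq> {}" if "F \<in> \<F>" for F using ne[OF that] finished by auto
  then show ?case by (intro exI[of _ "{}"] conjI ballI) simp_all
next
  case (token v B k)
  then obtain X where "finite X" "card X \<le> k" "\<forall>F\<in>\<F>. F \<inter> (insert v B \<union> X) \<noteq> {}" by blast
  then have "finite (insert v X)" "card (insert v X) \<le> Suc k"
    "\<forall>F\<in>\<F>. F \<inter> (B \<union> insert v X) \<noteq> {}"
    by (simp_all add: card_insert_if)
  then show ?case by (intro exI[of _ "insert v X"] conjI)
next
  case (change B B' k)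
  then obtain X where X: "finite X" "card X \<le> k" "\<forall>F\<in>\<F>. F \<inter> (B' \<union> X) \<noteq> {}" by blast
  obtain u w where u: "u \<in> verts G \<inter> B" "{x \<in> verts G - B. (u, x) \<in> adj G} = {w}" "B' = insert w B"
    using change(1) by (rule ccrE)
  \<comment> \<open>If \<open>F\<close> avoids \<open>B \<union> X\<close> but meets
    \<open>B' \<union> X\<close>, the meeting point can only be the newly coloured
    \<open>w\<close>.\<close>
  have "F \<inter> (B \<union> X) \<noteq> {}" if F: "F \<in> \<F>" for F
  proof
    assume e: "F \<inter> (B \<union> X) = {}"
    then have "F \<subseteq> verts G - B" using ne[OF F] by blast
    moreover have "w \<in> F" using X(3) F e u(3) by blast
    moreover have "u \<in> verts G - (verts G - B)" using u(1) by blast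
    ultimately show False using plain[OF F _ Diff_subset] u(2) by blast
  qed
  then show ?case by (intro exI[of _ X] conjI ballI X(1,2))
next
  case (oracle_move S B k)
  define W where "W = verts G - B"
  have sub: "W \<subseteq> verts G" by (auto simp: W_def)
  obtain T where T: "T \<subseteq> S" "T \<noteq> {}"
    and safe: "\<forall>F\<in>\<F>. F \<subseteq> W \<longrightarrow>
      (\<forall>u\<in>verts G - W. \<forall>w\<in>F. {x \<in> \<Union>T. (u, x) \<in> adj G} \<noteq> {w})"
    using oracle_answer[OF sub oracle_move(1)[folded W_def] oracle_move(2)]
    by (elim exE conjE)
  obtain B' X where B': "(ccr (induced G (B \<union> \<Union>T)))\<^sup>=\<^sup>= B B'"
    and X: "finite X" "card X \<le> k" "\<forall>F\<in>\<F>. F \<inter> (B' \<union> X) \<noteq> {}"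
    using oracle_move(3)[OF T] by blast
  have "U \<subseteq> W" if "U \<in> T" for U
    using that T(1) oracle_move(1) component_separated[OF sub, of U]
    unfolding W_def[symmetric] separated_def by blast
  then have TW: "\<Union>T \<subseteq> W" by (rule Union_least)
  have "F \<inter> (B \<union> X) \<noteq> {}" if F: "F \<in> \<F>" for F
  proof (cases "B' = B")
    case True
    then show ?thesis using X F by blast
  next
    case False
    then have "ccr (induced G (B \<union> \<Union>T)) B B'" using B' by auto
    then obtain u w where u: "u \<in> verts (induced G (B \<union> \<Union>T)) \<inter> B"
        "{x \<in> verts (induced G (B \<union> \<Union>T)) - B. (u, x) \<in> adj (induced G (B \<union> \<Union>T))} = {w}"
        "B' = insert w B"
      by (rule ccrE)
    \<comment> \<open>In the graph on which the rule is applied, the uncoloured neighbours of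
      \<open>u\<close> are precisely its neighbours in the answered components.\<close>
    have "{x \<in> verts (induced G (B \<union> \<Union>T)) - B. (u, x) \<in> adj (induced G (B \<union> \<Union>T))}
        = {x \<in> \<Union>T. (u, x) \<in> adj G}"
      using u(1) TW unfolding W_def by auto
    then have seen: "{x \<in> \<Union>T. (u, x) \<in> adj G} = {w}" using u(2) by simp
    show ?thesis
    proof
      assume e: "F \<inter> (B \<union> X) = {}"
      then have "F \<subseteq> W" using ne[OF F] unfolding W_def by blast
      moreover have "w \<in> F" using X(3) F e u(3) by blast
      moreover have "u \<in> verts G - W" using u(1) unfolding W_def by auto
      ultimately show False using safe F seen by meson
    qed
  qed
  then show ?case by (intro exI[of _ X] conjI ballI X(1,2))
qed

section \<open>Monotonicity in \<open>q\<close> and moves in terms of the uncoloured set\<close>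

text \<open>A selection of at least \<open>q + 1\<close> components is also large enough for
  \<open>q'\<close>, so the same strategy can be played.\<close>

lemma can_win_anti_mono:
  assumes "can_win q G k B" "q' \<le> q"
  shows "can_win q' G k B"
  using assms(1)
proof (induction rule: can_win.induct)
  case (oracle_move S B k)
  show ?case
    by (rule can_win.oracle_move[OF oracle_move(1)]) (use oracle_move assms(2) in auto)
qed (auto intro: can_win.intros)

lemma can_win_tokens:
  assumes "finite D" "D \<subseteq> verts G - B" "can_win q G k (B \<union> D)"
  shows "can_win q G (k + card D) B"
  using assms
proof (induction D arbitrary: B)
  case empty
  then show ?case by simp
next
  case (insert v D)
  have "can_win q G (k + card D) (insert v B)"
    using insert by (intro insert.IH) auto
  then have "can_win q G (Suc (k + card D)) B"
    using insert.prems by (intro can_win.token) auto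
  then show ?case using insert by simp
qed

text \<open>The form of all upper bounds: buy every vertex outside \<open>W\<close>, then colour
  \<open>W\<close> for free.\<close>

lemma Z_game_le:
  assumes "finite (verts G)" "can_win q G 0 (verts G - W)" "W \<subseteq> verts G"
  shows "Z_game q G \<le> card (verts G) - card W"
proof -
  have "can_win q G (0 + card (verts G - W)) {}"
    by (rule can_win_tokens) (use assms in auto)
  then have "Z_game q G \<le> card (verts G - W)"
    unfolding Z_game_def by (simp add: Least_le)
  then show ?thesis using assms by (simp add: card_Diff_subset finite_subset)
qed

lemma Z_game_mono:
  assumes "finite (verts G)" "q' \<le> q"
  shows "Z_game q' G \<le> Z_game q G"
  using can_win_anti_mono[OF can_win_Z_game[OF assms(1)] assms(2)]
  unfolding Z_game_def[of q'] by (rule Least_le)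

lemma can_win_change:
  assumes "W \<subseteq> verts G" "u \<in> verts G - W" "{x \<in> W. (u, x) \<in> adj G} = {w}"
    and "can_win q G k (verts G - (W - {w}))"
  shows "can_win q G k (verts G - W)"
proof (rule can_win.change)
  have "w \<in> W" using assms(3) by blast
  then have "verts G - (W - {w}) = insert w (verts G - W)" using assms(1) by blast
  moreover have "verts G - (verts G - W) = W" using assms(1) by blast
  ultimately show "ccr G (verts G - W) (verts G - (W - {w}))"
    unfolding ccr_def using assms(2,3) by auto
qed (rule assms(4))

text \<open>The oracle move in terms of the uncoloured set \<open>W\<close>: the player must be able
  to force some vertex after every answer, and both \<open>u\<close> and \<open>w\<close> may depend
  on that answer.\<close>

lemma can_win_oracle:
  assumes W: "W \<subseteq> verts G"
    and S: "S \<subseteq> components (induced G W)" "card S \<ge> q + 1"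
    and step: "\<And>T. \<lbrakk>T \<subseteq> S; T \<noteq> {}\<rbrakk> \<Longrightarrow> \<exists>u\<in>verts G - W. \<exists>w.
      {x \<in> \<Union>T. (u, x) \<in> adj G} = {w} \<and> can_win q G k (verts G - (W - {w}))"
  shows "can_win q G k (verts G - W)"
proof (rule can_win.oracle_move)
  have eq: "verts G - (verts G - W) = W" using W by blast
  show "S \<subseteq> components (induced G (verts G - (verts G - W)))" using S(1) eq by simp
  show "q + 1 \<le> card S" by fact
  fix T assume T: "T \<subseteq> S" "T \<noteq> {}"
  obtain u w where u: "u \<in> verts G - W" "{x \<in> \<Union>T. (u, x) \<in> adj G} = {w}"
    "can_win q G k (verts G - (W - {w}))" using step[OF T] by blast
  let ?B = "verts G - W"
  have "U \<subseteq> W" if "U \<in> T" for U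
    using that T(1) S(1) component_separated[OF W, of U] unfolding separated_def by blast
  then have TW: "\<Union>T \<subseteq> W" by (rule Union_least)
  have "{x \<in> verts G \<inter> (?B \<union> \<Union>T) - ?B. (u, x) \<in> adj G \<inter> (?B \<union> \<Union>T) \<times> (?B \<union> \<Union>T)}
      = {x \<in> \<Union>T. (u, x) \<in> adj G}"
    using u(1) TW W by auto
  moreover have "verts G - (W - {w}) = insert w ?B" using W u(2) TW by auto
  ultimately have "ccr (induced G (?B \<union> \<Union>T)) ?B (verts G - (W - {w}))"
    unfolding ccr_def verts_induced adj_induced using u(1,2) by auto
  then show "\<exists>B'. (ccr (induced G (?B \<union> \<Union>T)))\<^sup>=\<^sup>= ?B B' \<and> can_win q G k B'"
    using u(3) by blast
qed

section \<open>Double stars\<close>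

lemma verts_kneser: "verts (kneser n r) = {A. A \<subseteq> {1..n} \<and> card A = r}"
  by (simp add: kneser_def Let_def)

lemma adj_kneser:
  "(u, w) \<in> adj (kneser n r) \<longleftrightarrow> u \<in> verts (kneser n r) \<and> w \<in> verts (kneser n r) \<and> u \<inter> w = {}"
  by (simp add: kneser_def Let_def)

lemma sym_kneser: "sym (adj (kneser n r))"
  by (auto simp: sym_def adj_kneser)

lemma finite_verts_kneser [simp]: "finite (verts (kneser n r))"
  by (simp add: verts_kneser)

lemma card_verts_kneser: "card (verts (kneser n r)) = n choose r"
  by (simp add: verts_kneser n_subsets)

lemma pair_in_kneser: "{x, y} \<in> verts (kneser n 2) \<longleftrightarrow> x \<in> {1..n} \<and> y \<in> {1..n} \<and> x \<noteq> y"
  by (cases "x = y") (auto simp: verts_kneser)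

lemma kneser_pairE:
  assumes "u \<in> verts (kneser n 2)"
  obtains a b where "u = {a, b}" "a \<noteq> b" "a \<in> {1..n}" "b \<in> {1..n}"
  using assms by (auto simp: verts_kneser card_2_iff)

lemma kneser_neighbours:
  assumes "W \<subseteq> verts (kneser n r)" "u \<in> verts (kneser n r)"
  shows "{x \<in> W. (u, x) \<in> adj (kneser n r)} = {x \<in> W. u \<inter> x = {}}"
  using assms by (auto simp: adj_kneser)

text \<open>Two stars with centres \<open>x\<close>, \<open>y\<close> and leaf sets
  \<open>A\<close>, \<open>B\<close>. In the applications the leaf sets avoid both centres, so the
  edge \<open>{x, y}\<close> is absent.\<close>

definition double_star :: "'a \<Rightarrow> 'a \<Rightarrow> 'a set \<Rightarrow> 'a set \<Rightarrow> 'a set set" where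
  "double_star x y A B = (\<lambda>a. {x, a}) ` A \<union> (\<lambda>b. {y, b}) ` B"

lemma double_star_swap: "double_star x y A B = double_star y x B A"
  by (auto simp: double_star_def)

lemma card_double_star:
  assumes "finite A" "finite B" "x \<noteq> y" "x \<notin> A \<union> B" "y \<notin> A \<union> B"
  shows "card (double_star x y A B) = card A + card B"
proof -
  have "inj_on (\<lambda>a. {x, a}) A" "inj_on (\<lambda>b. {y, b}) B"
    by (auto simp: inj_on_def doubleton_eq_iff)
  moreover have "(\<lambda>a. {x, a}) ` A \<inter> (\<lambda>b. {y, b}) ` B = {}"
    using assms by (auto simp: doubleton_eq_iff)
  ultimately show ?thesis
    unfolding double_star_def using assms by (simp add: card_Un_disjoint card_image)
qed

lemma double_star_disjoint:
  "{v \<in> double_star x y A B. u \<inter> v = {}} =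
    double_star x y (if x \<in> u then {} else A - u) (if y \<in> u then {} else B - u)"
  by (auto simp: double_star_def)

text \<open>Two members are adjacent in the Kneser graph only if they are \<open>{x, a}\<close> and
  \<open>{y, b}\<close> with \<open>a \<noteq> b\<close>. The assumption \<open>conn\<close> says
  that this bipartite graph is connected, so the only nonempty separated set is the whole double
  star. It remains to count what \<open>u\<close> sees: \<open>{x, y}\<close> sees nothing, and
  \<open>xz\<close>, \<open>yz\<close>, \<open>zz\<close> treat \<open>{x, z}\<close>,
  \<open>{y, z}\<close> and \<open>{z, z'}\<close>.\<close>

lemma fort_double_star:
  assumes xy: "x \<in> {1..n}" "y \<in> {1..n}" "x \<noteq> y"
    and AB: "A \<subseteq> {1..n} - {x, y}" "B \<subseteq> {1..n} - {x, y}" "A \<noteq> {}"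
    and conn: "\<And>P Q. \<lbrakk>\<And>a b. \<lbrakk>a \<in> A; b \<in> B; a \<noteq> b\<rbrakk> \<Longrightarrow> P a \<longleftrightarrow> Q b;
        (\<exists>a\<in>A. P a) \<or> (\<exists>b\<in>B. Q b)\<rbrakk> \<Longrightarrow> (\<forall>a\<in>A. P a) \<and> (\<forall>b\<in>B. Q b)"
    and xz: "\<And>z. z \<in> {1..n} - {x, y} - A \<Longrightarrow> card (B - {z}) \<noteq> 1"
    and yz: "\<And>z. z \<in> {1..n} - {x, y} - B \<Longrightarrow> card (A - {z}) \<noteq> 1"
    and zz: "\<And>z z'. \<lbrakk>z \<in> {1..n} - {x, y}; z' \<in> {1..n} - {x, y}; z \<noteq> z'\<rbrakk>
      \<Longrightarrow> card (A - {z, z'}) + card (B - {z, z'}) \<noteq> 1"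
  shows "fort (kneser n 2) (double_star x y A B)"
proof -
  let ?F = "double_star x y A B" and ?V = "verts (kneser n 2)"
  have FV: "?F \<subseteq> ?V"
    using xy AB by (auto simp: double_star_def pair_in_kneser)
  have xs: "x \<notin> A \<union> B" "y \<notin> A \<union> B" using AB by auto
  have fin: "finite A" "finite B" using AB by (auto intro: finite_subset)
  \<comment> \<open>Membership in \<open>C\<close> is constant along adjacency, so
    \<open>conn\<close> applies with membership of \<open>{x, a}\<close> and of
    \<open>{y, b}\<close> as the two predicates.\<close>
  have all: "C = ?F" if C: "separated (kneser n 2) ?F C" "C \<noteq> {}" for C
  proof -
    have CF: "C \<subseteq> ?F" using C(1) by (simp add: separated_def)
    have iff: "{x, a} \<in> C \<longleftrightarrow> {y, b} \<in> C" if "a \<in> A" "b \<in> B" "a \<noteq> b" for a b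
    proof -
      have F: "{x, a} \<in> ?F" "{y, b} \<in> ?F" using that by (auto simp: double_star_def)
      then have "({x, a}, {y, b}) \<in> adj (kneser n 2)" "({y, b}, {x, a}) \<in> adj (kneser n 2)"
        using FV that xs xy(3) by (auto simp: adj_kneser)
      then show ?thesis using F C(1) unfolding separated_def by blast
    qed
    have "(\<exists>a\<in>A. {x, a} \<in> C) \<or> (\<exists>b\<in>B. {y, b} \<in> C)"
      using C(2) CF unfolding double_star_def by blast
    from conn[OF iff this] show ?thesis
      using CF unfolding double_star_def by blast
  qed
  have count: "card {v \<in> ?F. u \<inter> v = {}} =
      (if x \<in> u then 0 else card (A - u)) + (if y \<in> u then 0 else card (B - u))" for u
    unfolding double_star_disjoint using fin xy(3) xs by (subst card_double_star) auto
  have not1: "card {v \<in> ?F. u \<inter> v = {}} \<noteq> 1" if u: "u \<in> ?V - ?F" for u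
  proof -
    obtain p q where pq: "u = {p, q}" "p \<noteq> q" "p \<in> {1..n}" "q \<in> {1..n}"
      using u by (blast elim: kneser_pairE)
    consider "x \<in> u" "y \<in> u" | "x \<in> u" "y \<notin> u" | "x \<notin> u" "y \<in> u" | "x \<notin> u" "y \<notin> u" by blast
    then show ?thesis
    proof cases
      case 1
      then show ?thesis unfolding count by simp
    next
      case 2
      then obtain z where z: "u = {x, z}" "z \<in> {1..n}" "z \<noteq> x" "z \<noteq> y"
        using pq by (metis insert_iff insert_commute singletonD)
      then have "z \<notin> A" using u by (auto simp: double_star_def)
      moreover have "B - u = B - {z}" using z xs by auto
      ultimately show ?thesis unfolding count using 2 xz z by simp
    next
      case 3
      then obtain z where z: "u = {y, z}" "z \<in> {1..n}" "z \<noteq> x" "z \<noteq> y"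
        using pq by (metis insert_iff insert_commute singletonD)
      then have "z \<notin> B" using u by (auto simp: double_star_def)
      moreover have "A - u = A - {z}" using z xs by auto
      ultimately show ?thesis unfolding count using 3 yz z by simp
    next
      case 4
      then show ?thesis unfolding count using zz[of p q] pq by simp
    qed
  qed
  show ?thesis
    unfolding fort_def
  proof (intro conjI allI impI ballI)
    show "?F \<noteq> {}" using AB(3) by (auto simp: double_star_def)
    show "?F \<subseteq> ?V" by (rule FV)
    fix C u w assume C: "separated (kneser n 2) ?F C" and u: "u \<in> ?V - ?F"
    show "{v \<in> C. (u, v) \<in> adj (kneser n 2)} \<noteq> {w}"
    proof
      assume eq: "{v \<in> C. (u, v) \<in> adj (kneser n 2)} = {w}"
      then have "C = ?F" using all[OF C] by blast
      moreover have "u \<in> ?V" using u by blast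
      ultimately have "{v \<in> ?F. u \<inter> v = {}} = {w}"
        using eq kneser_neighbours[OF FV] by simp
      then show False using not1[OF u] by simp
    qed
  qed
qed

lemma card_Diff_pair_ge: "card A - 2 \<le> card (A - {z, z'})"
proof -
  have "card {z, z'} \<le> 2" by (simp add: card_insert_if)
  then show ?thesis using diff_card_le_card_Diff[of "{z, z'}" A] by simp
qed

lemma card_Diff_single_ge: "card A - 1 \<le> card (A - {z})"
  using diff_card_le_card_Diff[of "{z}" A] by simp

lemma ex_other:
  assumes "card A \<ge> 3"
  shows "\<exists>a\<in>A. a \<noteq> p \<and> a \<noteq> q"
proof -
  have "card (A - {p, q}) \<noteq> 0" using card_Diff_pair_ge[of A p q] assms by linarith
  then have "A - {p, q} \<noteq> {}" by (metis card.empty)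
  then show ?thesis by blast
qed

context
  fixes n x y :: nat and A B :: "nat set"
  assumes xy: "x \<in> {1..n}" "y \<in> {1..n}" "x \<noteq> y"
    and AB: "A \<subseteq> {1..n} - {x, y}" "B \<subseteq> {1..n} - {x, y}"
begin

text \<open>Any two leaves on one side differ from a third leaf on the other, which gives a common
  neighbour and hence connectedness. Deleting one point leaves two leaves on a side, deleting two
  points leaves one on each side, so the count is never one.\<close>

lemma fort_double_star_3_3:
  assumes "card A \<ge> 3" "card B \<ge> 3"
  shows "fort (kneser n 2) (double_star x y A B)"
proof (rule fort_double_star[OF xy AB])
  show "A \<noteq> {}" using assms(1) by auto
  show "card (B - {z}) \<noteq> 1" for z using card_Diff_single_ge[of B z] assms by linarith
  show "card (A - {z}) \<noteq> 1" for z using card_Diff_single_ge[of A z] assms by linarith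
  show "card (A - {z, z'}) + card (B - {z, z'}) \<noteq> 1" for z z'
    using card_Diff_pair_ge[of A z z'] card_Diff_pair_ge[of B z z'] assms by linarith
  fix P Q :: "nat \<Rightarrow> bool"
  assume iff: "\<And>a b. \<lbrakk>a \<in> A; b \<in> B; a \<noteq> b\<rbrakk> \<Longrightarrow> P a \<longleftrightarrow> Q b"
  have P: "P a \<longleftrightarrow> P a'" if "a \<in> A" "a' \<in> A" for a a'
    using ex_other[OF assms(2), of a a'] iff that by metis
  have Q: "Q b \<longleftrightarrow> Q b'" if "b \<in> B" "b' \<in> B" for b b'
    using ex_other[OF assms(1), of b b'] iff that by metis
  obtain a where a: "a \<in> A" using ex_other[OF assms(1)] by blast
  obtain b where "b \<in> B" "a \<noteq> b" using ex_other[OF assms(2), of a a] by blast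
  then show "(\<exists>a\<in>A. P a) \<or> (\<exists>b\<in>B. Q b) \<Longrightarrow> (\<forall>a\<in>A. P a) \<and> (\<forall>b\<in>B. Q b)"
    using a P Q iff by metis
qed

text \<open>A leaf \<open>c\<close> of \<open>A\<close> outside \<open>B\<close> is joined to both
  edges at \<open>y\<close>, and every other leaf of \<open>A\<close> differs from one of the two
  points of \<open>B\<close>. Since \<open>B \<subseteq> A\<close>, a point outside \<open>A\<close>
  removes nothing from \<open>B\<close>.\<close>

lemma fort_double_star_4_2:
  assumes "card A \<ge> 4" "card B = 2" "B \<subseteq> A"
  shows "fort (kneser n 2) (double_star x y A B)"
proof (rule fort_double_star[OF xy AB])
  show "A \<noteq> {}" using assms(1) by auto
  show "card (B - {z}) \<noteq> 1" if "z \<in> {1..n} - {x, y} - A" for z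
  proof -
    have "B - {z} = B" using that assms(3) by blast
    then show ?thesis using assms(2) by simp
  qed
  show "card (A - {z}) \<noteq> 1" for z using card_Diff_single_ge[of A z] assms by linarith
  show "card (A - {z, z'}) + card (B - {z, z'}) \<noteq> 1" for z z'
    using card_Diff_pair_ge[of A z z'] assms by linarith
  fix P Q :: "nat \<Rightarrow> bool"
  assume iff: "\<And>a b. \<lbrakk>a \<in> A; b \<in> B; a \<noteq> b\<rbrakk> \<Longrightarrow> P a \<longleftrightarrow> Q b"
  obtain b b' where B: "B = {b, b'}" "b \<noteq> b'" using assms(2) by (auto simp: card_2_iff)
  obtain c where c: "c \<in> A" "c \<noteq> b" "c \<noteq> b'" using ex_other[of A b b'] assms(1) by auto
  have Q: "P c \<longleftrightarrow> Q b''" if "b'' \<in> B" for b'' using iff[OF c(1)] that c B by auto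
  have P: "P a \<longleftrightarrow> P c" if "a \<in> A" for a
    using iff[OF that, of b] iff[OF that, of b'] Q B by auto
  show "(\<exists>a\<in>A. P a) \<or> (\<exists>b\<in>B. Q b) \<Longrightarrow> (\<forall>a\<in>A. P a) \<and> (\<forall>b\<in>B. Q b)"
    using P Q by blast
qed

end

text \<open>The single edge \<open>{y, b}\<close> is joined to all edges at \<open>x\<close>, of
  which there are \<open>n - 3\<close>, hence at least three. The only missing edge at
  \<open>x\<close> with a leaf other than \<open>y\<close> is \<open>{x, b}\<close>, and it meets
  \<open>{y, b}\<close>.\<close>

lemma fort_double_star_spanning:
  assumes xy: "x \<in> {1..n}" "y \<in> {1..n}" "x \<noteq> y" and b: "b \<in> {1..n} - {x, y}" and n: "n \<ge> 6"
  shows "fort (kneser n 2) (double_star x y ({1..n} - {x, y, b}) {b})"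
proof -
  let ?A = "{1..n} - {x, y, b}"
  have "card ?A = card {1..n} - card {x, y, b}"
    by (rule card_Diff_subset) (use xy b in auto)
  moreover have "card {x, y, b} = 3" using xy b by auto
  ultimately have card: "card ?A \<ge> 3" using n by simp
  show ?thesis
  proof (rule fort_double_star[OF xy])
    show "?A \<subseteq> {1..n} - {x, y}" "{b} \<subseteq> {1..n} - {x, y}" using b by auto
    show "?A \<noteq> {}" using card by (metis card.empty not_numeral_le_zero)
    show "card ({b} - {z}) \<noteq> 1" if "z \<in> {1..n} - {x, y} - ?A" for z
    proof -
      have "z = b" using that by blast
      then show ?thesis by simp
    qed
    show "card (?A - {z}) \<noteq> 1" for z using card_Diff_single_ge[of ?A z] card by linarith
    show "card (?A - {z, z'}) + card ({b} - {z, z'}) \<noteq> 1" if "z \<noteq> z'" for z z'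
    \<comment> \<open>If \<open>b\<close> is one of the deleted points, only one leaf can be lost
      from \<open>?A\<close>, leaving at least two. Otherwise \<open>b\<close> contributes one and
      \<open>?A\<close> at least one more.\<close>
    proof (cases "b = z \<or> b = z'")
      case True
      then have "?A - {z, z'} = ?A - {z} \<or> ?A - {z, z'} = ?A - {z'}" by blast
      then have "card ?A - 1 \<le> card (?A - {z, z'})" using card_Diff_single_ge by metis
      then show ?thesis using card by linarith
    next
      case False
      then have "{b} - {z, z'} = {b}" by blast
      then have "card ({b} - {z, z'}) = 1" by simp
      moreover have "card (?A - {z, z'}) \<ge> 1" using card_Diff_pair_ge[of ?A z z'] card by linarith
      ultimately show ?thesis by linarith
    qed
  qed auto
qed

section \<open>Forts in large sets of uncoloured vertices\<close>

lemma double_star_mono: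
  "\<lbrakk>A \<subseteq> A'; B \<subseteq> B'\<rbrakk> \<Longrightarrow> double_star x y A B \<subseteq> double_star x y A' B'"
  by (auto simp: double_star_def)

lemma card_Diff_two:
  assumes "x \<in> {1..n}" "y \<in> {1..n}" "x \<noteq> (y::nat)"
  shows "card ({1..n} - {x, y}) = n - 2"
  using assms by (subst card_Diff_subset) auto

lemma ex_fort_in_spanning_double_star:
  assumes "x \<in> {1..n}" "y \<in> {1..n}" "x \<noteq> y" "n \<ge> 6"
    and "b \<in> {1..n} - {x, y}" "b \<in> B" "{1..n} - {x, y} \<subseteq> insert b A"
    and W: "double_star x y A B \<subseteq> W"
  shows "\<exists>F\<subseteq>W. fort (kneser n 2) F"
proof -
  have "{1..n} - {x, y, b} \<subseteq> A" "{b} \<subseteq> B" using assms(6,7) by auto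
  then have "double_star x y ({1..n} - {x, y, b}) {b} \<subseteq> W"
    using double_star_mono W by (meson subset_trans)
  then show ?thesis using fort_double_star_spanning[OF assms(1-3,5,4)] by blast
qed

text \<open>Three leaves on the smaller side already give a fort. With at most two there, the larger
  side must contain almost all points, which leads to the spanning double star or, for
  \<open>n = 7\<close>, possibly to the one with four and two leaves.\<close>

lemma ex_fort_in_double_star_ordered:
  assumes xy: "x \<in> {1..n}" "y \<in> {1..n}" "x \<noteq> y"
    and AB: "A \<subseteq> {1..n} - {x, y}" "B \<subseteq> {1..n} - {x, y}"
    and W: "double_star x y A B \<subseteq> W"
    and large: "card A + card B \<ge> (if n \<ge> 8 then n else 6)" and le: "card B \<le> card A"
  shows "\<exists>F\<subseteq>W. fort (kneser n 2) F"
proof (cases "card B \<ge> 3")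
  case True
  then show ?thesis using fort_double_star_3_3[OF xy AB] le W by auto
next
  case B: False
  let ?R = "{1..n} - {x, y}"
  have R: "card ?R = n - 2" by (rule card_Diff_two[OF xy])
  have A_le: "card A \<le> n - 2" using card_mono[OF _ AB(1)] R by simp
  have A_ge: "card A \<ge> 4" using large B by (auto split: if_splits)
  show ?thesis
  proof (cases "A = ?R")
    case True
    \<comment> \<open>At most \<open>n - 2\<close> leaves lie at \<open>x\<close>, fewer than the
      required total both for \<open>n \<ge> 8\<close> and for \<open>n \<le> 7\<close>.\<close>
    have "card B \<noteq> 0" using large A_le A_ge by (auto split: if_splits)
    then obtain b where b: "b \<in> B" by (metis card.empty ex_in_conv)
    have "n \<ge> 6" using A_ge A_le by simp
    then show ?thesis
      by (rule ex_fort_in_spanning_double_star[OF xy _ _ b _ W]) (use AB True b in auto)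
  next
    case False
    then have "card A < n - 2" using psubset_card_mono[of ?R A] AB(1) R by auto
    \<comment> \<open>For \<open>n \<ge> 8\<close> two leaves at \<open>y\<close> force
      \<open>n - 2\<close> leaves at \<open>x\<close>. For \<open>n \<le> 7\<close> there are at
      least four leaves but fewer than \<open>n - 2\<close>, which leaves only
      \<open>n = 7\<close>.\<close>
    then have n: "n = 7" "card A = 4" "card B = 2" using large A_ge B by (auto split: if_splits)
    show ?thesis
    proof (cases "B \<subseteq> A")
      case True
      then show ?thesis using fort_double_star_4_2[OF xy AB] n W by auto
    next
      case False
      then obtain b where b: "b \<in> B" "b \<notin> A" by blast
      have "finite A" using AB(1) by (rule finite_subset) simp
      then have "card (insert b A) = card ?R" using n b R by simp
      then have "insert b A = ?R" using AB b by (intro card_subset_eq) auto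
      then show ?thesis
        by (intro ex_fort_in_spanning_double_star[OF xy _ _ b(1) _ W]) (use AB b n in auto)
    qed
  qed
qed

lemma ex_fort_in_double_star:
  assumes xy: "x \<in> {1..n}" "y \<in> {1..n}" "x \<noteq> y"
    and AB: "A \<subseteq> {1..n} - {x, y}" "B \<subseteq> {1..n} - {x, y}"
    and W: "double_star x y A B \<subseteq> W"
    and large: "card A + card B \<ge> (if n \<ge> 8 then n else 6)"
  shows "\<exists>F\<subseteq>W. fort (kneser n 2) F"
proof (cases "card B \<le> card A")
  case True
  then show ?thesis by (rule ex_fort_in_double_star_ordered[OF xy AB W large])
next
  case False
  have swapped: "B \<subseteq> {1..n} - {y, x}" "A \<subseteq> {1..n} - {y, x}" "double_star y x B A \<subseteq> W"
    "card B + card A \<ge> (if n \<ge> 8 then n else 6)" "card A \<le> card B"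
    using AB W large False by (auto simp: double_star_swap[of y x] add.commute)
  show ?thesis by (rule ex_fort_in_double_star_ordered[OF xy(2,1) xy(3)[symmetric] swapped])
qed

section \<open>Structure of sets that are not forts\<close>

text \<open>Take for \<open>A\<close> and \<open>B\<close> all leaves occurring in \<open>W\<close>.
  Apart from possibly \<open>e\<close>, every edge of \<open>W\<close> has exactly one end in
  \<open>{x, y}\<close>, which accounts for the \<open>Suc\<close>.\<close>

lemma double_star_of_cover:
  assumes WV: "W \<subseteq> verts (kneser n 2)"
    and xy: "x \<in> {1..n}" "y \<in> {1..n}" "x \<noteq> y"
    and cover: "\<forall>v\<in>W. v \<noteq> e \<longrightarrow> v \<inter> {x, y} \<noteq> {} \<and> v \<noteq> {x, y}"
  shows "\<exists>A B. A \<subseteq> {1..n} - {x, y} \<and> B \<subseteq> {1..n} - {x, y} \<and> double_star x y A B \<subseteq> W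
      \<and> card W \<le> Suc (card A + card B)"
proof -
  define A where "A = {a \<in> {1..n} - {x, y}. {x, a} \<in> W}"
  define B where "B = {b \<in> {1..n} - {x, y}. {y, b} \<in> W}"
  have fin: "finite A" "finite B" by (auto simp: A_def B_def)
  have "W \<subseteq> insert e (double_star x y A B)"
  proof
    fix v assume v: "v \<in> W"
    then obtain p q where pq: "v = {p, q}" "p \<noteq> q" "p \<in> {1..n}" "q \<in> {1..n}"
      using WV by (blast elim: kneser_pairE)
    show "v \<in> insert e (double_star x y A B)"
    proof (cases "v = e")
      case False
      then have "v \<inter> {x, y} \<noteq> {}" "v \<noteq> {x, y}" using cover v by auto
      then obtain z where "z \<in> {1..n} - {x, y}" "v = {x, z} \<or> v = {y, z}"
        using pq by (cases "p \<in> {x, y}") auto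
      then show ?thesis using v by (auto simp: double_star_def A_def B_def)
    qed simp
  qed
  then have "card W \<le> card (insert e (double_star x y A B))"
    by (intro card_mono) (auto simp: double_star_def fin)
  also have "\<dots> \<le> Suc (card (double_star x y A B))"
    by (rule card_insert_le_m1[THEN order_trans]) auto
  also have "card (double_star x y A B) = card A + card B"
    by (rule card_double_star) (use fin xy in \<open>auto simp: A_def B_def\<close>)
  finally have "card W \<le> Suc (card A + card B)" .
  moreover have "double_star x y A B \<subseteq> W" by (auto simp: double_star_def A_def B_def)
  moreover have "A \<subseteq> {1..n} - {x, y}" "B \<subseteq> {1..n} - {x, y}" by (auto simp: A_def B_def)
  ultimately show ?thesis by blast
qed

lemma kneser_pair_subset_Un:
  assumes "v \<in> verts (kneser n 2)" "v \<inter> s \<noteq> {}" "v \<inter> t \<noteq> {}" "s \<inter> t = {}"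
  shows "v \<subseteq> s \<union> t"
  using assms by (auto elim!: kneser_pairE)

lemma card_kneser_pair: "v \<in> verts (kneser n r) \<Longrightarrow> card v = r \<and> finite v \<and> v \<subseteq> {1..n}"
  by (auto simp: verts_kneser intro: finite_subset)

text \<open>An edge in \<open>C\<close> meets every edge of \<open>W - C\<close>. So
  \<open>w'\<close> lies in \<open>C\<close> and \<open>d'\<close> outside, and each edge outside
  \<open>C\<close> has one end in \<open>w\<close> and one in \<open>w'\<close>. In particular
  \<open>d\<close> and \<open>d'\<close> fill the same four points, which in turn confines the edges
  of \<open>C\<close> to them.\<close>

lemma disconnected_pairs:
  assumes WV: "W \<subseteq> verts (kneser n 2)"
    and C: "separated (kneser n 2) W C" and w: "w \<in> C" "w' \<in> W" "w \<inter> w' = {}"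
    and d: "d \<in> W - C" "d' \<in> W" "d \<inter> d' = {}"
  shows "card (w \<union> w') = 4 \<and> w \<union> w' \<subseteq> {1..n} \<and> (\<forall>v\<in>W. v \<subseteq> w \<union> w')"
proof -
  have CW: "C \<subseteq> W" using C by (simp add: separated_def)
  have meet: "c \<inter> d \<noteq> {}" if "c \<in> C" "d \<in> W - C" for c d
    using that C CW WV unfolding separated_def adj_kneser by blast
  have w'C: "w' \<in> C" using meet[of w w'] w by blast
  have d'C: "d' \<in> W - C" using meet[of d' d] d by blast
  have V: "w \<in> verts (kneser n 2)" "w' \<in> verts (kneser n 2)" "d \<in> verts (kneser n 2)"
      "d' \<in> verts (kneser n 2)"
    using w d WV CW by auto
  have cards: "card (w \<union> w') = 4" "card (d \<union> d') = 4"
    using V w(3) d(3) by (simp_all add: card_Un_disjoint card_kneser_pair)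
  have outside: "v \<subseteq> w \<union> w'" if "v \<in> W - C" for v
    using kneser_pair_subset_Un[of v n w w'] meet[OF w(1) that] meet[OF w'C that] that w(3) WV
    by (auto simp: Int_commute)
  have "d \<union> d' \<subseteq> w \<union> w'" using outside d(1) d'C by blast
  then have eq: "d \<union> d' = w \<union> w'"
    using cards V by (intro card_subset_eq) (auto simp: card_kneser_pair)
  have "v \<subseteq> w \<union> w'" if "v \<in> C" for v
    using kneser_pair_subset_Un[of v n d d'] meet[OF that d(1)] meet[OF that d'C] that d(3) WV CW eq
    by auto
  then have "\<forall>v\<in>W. v \<subseteq> w \<union> w'" using outside by blast
  then show ?thesis using cards(1) card_kneser_pair[OF V(1)] card_kneser_pair[OF V(2)] by simp
qed

lemma not_fort_cases:
  assumes WV: "W \<subseteq> verts (kneser n 2)" "W \<noteq> {}" and nf: "\<not> fort (kneser n 2) W"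
  obtains (K4) Q where "card Q = 4" "Q \<subseteq> {1..n}" "\<forall>v\<in>W. v \<subseteq> Q"
  | (double_star) x y A B where "x \<in> {1..n}" "y \<in> {1..n}" "x \<noteq> y"
      "A \<subseteq> {1..n} - {x, y}" "B \<subseteq> {1..n} - {x, y}" "double_star x y A B \<subseteq> W"
      "card W \<le> Suc (card A + card B)"
proof -
  obtain C u w where C: "separated (kneser n 2) W C" and u: "u \<in> verts (kneser n 2) - W"
    and seen: "{v \<in> C. (u, v) \<in> adj (kneser n 2)} = {w}"
    using nf WV unfolding fort_def by auto
  have CW: "C \<subseteq> W" using C by (simp add: separated_def)
  have wC: "w \<in> C" using seen by blast
  \<comment> \<open>If \<open>C = W\<close>, the forcing vertex \<open>u\<close> meets all edges of
    \<open>W\<close> except \<open>w\<close>. If some \<open>e\<close> in \<open>W\<close> meets all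
    of \<open>W\<close>, its own ends serve as centres. Otherwise \<open>w\<close> and an edge
    outside \<open>C\<close> both have disjoint partners in \<open>W\<close>, and \<open>W\<close>
    lives on four points.\<close>
  consider "C = W" | e where "e \<in> W" "\<forall>v\<in>W. e \<inter> v \<noteq> {}"
    | "C \<noteq> W" "\<not> (\<exists>e\<in>W. \<forall>v\<in>W. e \<inter> v \<noteq> {})"
    by blast
  then show thesis
  proof cases
    case 1
    obtain x y where xy: "u = {x, y}" "x \<noteq> y" "x \<in> {1..n}" "y \<in> {1..n}"
      using u by (blast elim: kneser_pairE)
    have "\<forall>v\<in>W. v \<noteq> w \<longrightarrow> v \<inter> {x, y} \<noteq> {} \<and> v \<noteq> {x, y}"
    proof (intro ballI impI)
      fix v assume that: "v \<in> W" "v \<noteq> w"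
      have "(u, v) \<notin> adj (kneser n 2)" using seen 1 that by blast
      then have "u \<inter> v \<noteq> {}" using u that WV by (auto simp: adj_kneser)
      then show "v \<inter> {x, y} \<noteq> {} \<and> v \<noteq> {x, y}" using xy(1) u that by auto
    qed
    from double_star_of_cover[OF WV(1) xy(3,4,2) this] show thesis
      by (elim exE conjE) (rule double_star[OF xy(3,4,2)])
  next
    case 2
    obtain x y where xy: "e = {x, y}" "x \<noteq> y" "x \<in> {1..n}" "y \<in> {1..n}"
      using 2 WV by (blast elim: kneser_pairE)
    have "\<forall>v\<in>W. v \<noteq> e \<longrightarrow> v \<inter> {x, y} \<noteq> {} \<and> v \<noteq> {x, y}"
      using 2(2) unfolding xy(1) by blast
    from double_star_of_cover[OF WV(1) xy(3,4,2) this] show thesis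
      by (elim exE conjE) (rule double_star[OF xy(3,4,2)])
  next
    case 3
    obtain d where d: "d \<in> W - C" using 3(1) CW by blast
    obtain d' where d': "d' \<in> W" "d \<inter> d' = {}" using 3(2) d by blast
    obtain w' where w': "w' \<in> W" "w \<inter> w' = {}" using 3(2) wC CW by blast
    show thesis
      using disconnected_pairs[OF WV(1) C wC w' d d'] K4 by blast
  qed
qed

lemma card_pairs_of_4:
  assumes "card Q = 4" "W \<subseteq> verts (kneser n 2)" "\<forall>v\<in>W. v \<subseteq> Q"
  shows "card W \<le> 6"
proof -
  have fin: "finite Q" using assms(1) by (metis card.infinite zero_neq_numeral)
  have "W \<subseteq> {v. v \<subseteq> Q \<and> card v = 2}" using assms by (auto simp: verts_kneser)
  then have "card W \<le> card {v. v \<subseteq> Q \<and> card v = 2}" using fin by (intro card_mono) auto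
  also have "\<dots> = 6" using fin assms(1) by (simp add: n_subsets numeral_eq_Suc)
  finally show ?thesis .
qed

text \<open>Four points carry only six edges, so a set of seven that is not a fort contains a double
  star with at most one edge less. This is why the thresholds exceed those for double stars by
  one.\<close>

lemma ex_fort:
  assumes "W \<subseteq> verts (kneser n 2)" "card W \<ge> (if n \<ge> 8 then n + 1 else 7)"
  shows "\<exists>F\<subseteq>W. fort (kneser n 2) F"
proof (cases "fort (kneser n 2) W")
  case False
  have "card W \<ge> 7" using assms(2) by (auto split: if_splits)
  then have "W \<noteq> {}" by auto
  from assms(1) this False show ?thesis
  proof (cases rule: not_fort_cases)
    case (K4 Q)
    then show ?thesis using card_pairs_of_4[OF K4(1) assms(1)] \<open>card W \<ge> 7\<close> by auto
  next
    case (double_star x y A B)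
    then show ?thesis
      using assms(2) by (intro ex_fort_in_double_star[OF double_star(1-6)]) (auto split: if_splits)
  qed
qed blast

text \<open>The oracle simply returns the whole selection, which forts resist for every
  \<open>q\<close>. The bought vertices then meet every fort, so their complement contains none and
  is small.\<close>

lemma Z_game_kneser_ge:
  "(n choose 2) - (if n \<ge> 8 then n else 6) \<le> Z_game q (kneser n 2)"
proof -
  let ?G = "kneser n 2"
  let ?\<F> = "Collect (fort ?G)"
  have plain: "{x \<in> W. (u, x) \<in> adj ?G} \<noteq> {w}"
    if "F \<in> ?\<F>" "F \<subseteq> W" "W \<subseteq> verts ?G" "u \<in> verts ?G - W" "w \<in> F" for F W u w
    by (rule fort_not_forced[of _ F W]) (use that in \<open>auto simp: separated_def\<close>)
  have oracle_answer: "\<exists>T\<subseteq>S. T \<noteq> {} \<and> (\<forall>F\<in>?\<F>. F \<subseteq> W \<longrightarrow>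
      (\<forall>u\<in>verts ?G - W. \<forall>w\<in>F. {x \<in> \<Union>T. (u, x) \<in> adj ?G} \<noteq> {w}))"
    if "W \<subseteq> verts ?G" "S \<subseteq> components (induced ?G W)" "card S \<ge> q + 1" for W S
  proof (intro exI[of _ S] conjI ballI impI)
    show "S \<noteq> {}" using that(3) by auto
    have "separated ?G W (\<Union>S)"
      using that component_separated by (intro separated_Union) blast
    then show "{x \<in> \<Union>S. (u, x) \<in> adj ?G} \<noteq> {w}"
      if "F \<in> ?\<F>" "F \<subseteq> W" "u \<in> verts ?G - W" "w \<in> F" for F u w
      using that by (intro fort_not_forced) auto
  qed simp
  have "can_win q ?G (Z_game q ?G) {}" by (rule can_win_Z_game) simp
  then have "\<exists>X. finite X \<and> card X \<le> Z_game q ?G \<and> (\<forall>F\<in>?\<F>. F \<inter> ({} \<union> X) \<noteq> {})"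
    by (rule can_win_hitting_set[OF _ _ plain oracle_answer]) (auto simp: fort_def)
  then obtain X where X: "finite X" "card X \<le> Z_game q ?G" "\<forall>F\<in>?\<F>. F \<inter> X \<noteq> {}" by auto
  have "\<not> (\<exists>F\<subseteq>verts ?G - X. fort ?G F)" using X(3) by blast
  then have "card (verts ?G - X) < (if n \<ge> 8 then n + 1 else 7)"
    using ex_fort[of "verts ?G - X" n] by (meson Diff_subset not_le_imp_less)
  moreover have "card (verts ?G) - card X \<le> card (verts ?G - X)"
    using X(1) by (rule diff_card_le_card_Diff)
  ultimately show ?thesis
    using X(2) by (auto simp: card_verts_kneser split: if_splits)
qed

section \<open>Four-cycles and the game with \<open>q = 1\<close>\<close>

text \<open>In the Kneser graph such a set induces two disjoint edges, formed by the opposite sides.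
  For \<open>n \<ge> 5\<close> it is not a fort: of the separated pair \<open>{a, b}\<close>,
  \<open>{c, d}\<close> a vertex \<open>{a, e}\<close> with \<open>e\<close> off the cycle sees only
  \<open>{c, d}\<close>.\<close>

definition four_cycles :: "nat \<Rightarrow> nat set set set" where
  "four_cycles n = {{{a, b}, {b, c}, {c, d}, {d, a}} | a b c d.
    distinct [a, b, c, d] \<and> {a, b, c, d} \<subseteq> {1..n}}"

lemma four_cycleI:
  "\<lbrakk>distinct [a, b, c, d]; {a, b, c, d} \<subseteq> {1..n}\<rbrakk>
    \<Longrightarrow> {{a, b}, {b, c}, {c, d}, {d, a}} \<in> four_cycles n"
  unfolding four_cycles_def by blast

text \<open>Rotating the cycle makes any prescribed side the first one.\<close>

lemma four_cycleE:
  assumes "F \<in> four_cycles n" "w \<in> F"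
  obtains a b c d where "distinct [a, b, c, d]" "{a, b, c, d} \<subseteq> {1..n}"
    "F = {{a, b}, {b, c}, {c, d}, {d, a}}" "w = {a, b}"
proof -
  obtain a b c d where F: "distinct [a, b, c, d]" "{a, b, c, d} \<subseteq> {1..n}"
    "F = {{a, b}, {b, c}, {c, d}, {d, a}}"
    using assms(1) unfolding four_cycles_def by blast
  then consider "w = {a, b}" | "w = {b, c}" | "w = {c, d}" | "w = {d, a}" using assms(2) by blast
  then show thesis
  proof cases
    case 1
    show thesis by (rule that[OF F 1])
  next
    case 2
    show thesis by (rule that[of b c d a, OF _ _ _ 2]) (use F in auto)
  next
    case 3
    show thesis by (rule that[of c d a b, OF _ _ _ 3]) (use F in auto)
  next
    case 4
    show thesis by (rule that[of d a b c, OF _ _ _ 4]) (use F in auto)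
  qed
qed

lemma four_cycle_subset: "F \<in> four_cycles n \<Longrightarrow> F \<subseteq> verts (kneser n 2)"
  unfolding four_cycles_def by (auto simp: pair_in_kneser)

lemma four_cycle_opposite:
  assumes "F \<in> four_cycles n" "w \<in> F"
  obtains w' where "w' \<in> F" "w \<inter> w' = {}"
  by (rule four_cycleE[OF assms]) (use that in auto)

text \<open>A pair that misses the side \<open>{a, b}\<close> but meets both neighbouring sides
  contains \<open>c\<close> and \<open>d\<close>, so it is itself a side of the cycle.\<close>

lemma four_cycle_not_forced:
  assumes "F \<in> four_cycles n" "u \<in> verts (kneser n 2) - F"
  shows "{v \<in> F. u \<inter> v = {}} \<noteq> {w}"
proof
  assume eq: "{v \<in> F. u \<inter> v = {}} = {w}"
  then have w: "w \<in> F" "u \<inter> w = {}" by auto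
  have meet: "u \<inter> v \<noteq> {}" if "v \<in> F" "v \<noteq> w" for v using eq that by blast
  obtain a b c d where F: "distinct [a, b, c, d]"
    "F = {{a, b}, {b, c}, {c, d}, {d, a}}" "w = {a, b}"
    by (rule four_cycleE[OF assms(1) w(1)])
  have "{b, c} \<noteq> w" "{d, a} \<noteq> w" using F(1,3) by (auto simp: doubleton_eq_iff)
  moreover have "{b, c} \<in> F" "{d, a} \<in> F" using F(2) by auto
  ultimately have "u \<inter> {b, c} \<noteq> {}" "u \<inter> {d, a} \<noteq> {}" using meet by blast+
  then have "c \<in> u" "d \<in> u" using w F(3) by auto
  moreover obtain p q where "u = {p, q}" using assms(2) by (blast elim: kneser_pairE)
  ultimately have "u = {c, d}" using F(1) by auto
  then show False using assms(2) F(2) by blast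
qed

text \<open>Each side has its opposite side as a disjoint partner in \<open>W\<close>, so a
  separated set cutting the cycle supplies the two disjoint pairs needed for
  \<open>disconnected_pairs\<close>.\<close>

lemma four_cycle_split:
  assumes WV: "W \<subseteq> verts (kneser n 2)" and C: "separated (kneser n 2) W C"
    and F: "F \<in> four_cycles n" "F \<subseteq> W" "w \<in> F" "w \<in> C" "\<not> F \<subseteq> C"
  obtains Q where "card Q = 4" "\<forall>v\<in>W. v \<subseteq> Q"
proof -
  obtain w' where w': "w' \<in> F" "w \<inter> w' = {}" by (rule four_cycle_opposite[OF F(1,3)])
  obtain d where d: "d \<in> F" "d \<notin> C" using F by blast
  obtain d' where d': "d' \<in> F" "d \<inter> d' = {}" by (rule four_cycle_opposite[OF F(1) d(1)])
  have "card (w \<union> w') = 4 \<and> w \<union> w' \<subseteq> {1..n} \<and> (\<forall>v\<in>W. v \<subseteq> w \<union> w')"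
    by (rule disconnected_pairs[OF WV C F(4) _ w'(2) _ _ d'(2)]) (use w' d d' F(2) in auto)
  then show thesis using that[of "w \<union> w'"] by simp
qed

text \<open>The two opposite pairs of a 4-cycle can only lie in different components if \<open>W\<close> lives on four
  points; in that case answering with the whole selection is safe.\<close>

lemma four_cycle_not_forced_by_components:
  assumes WV: "W \<subseteq> verts (kneser n 2)"
    and S: "S \<subseteq> components (induced (kneser n 2) W)" "card S \<ge> 2"
    and nontrivial: "\<And>e. {e} \<notin> S"
    and F: "F \<in> four_cycles n" "F \<subseteq> W" "w \<in> F" and u: "u \<in> verts (kneser n 2) - W"
  shows "{v \<in> \<Union>S. u \<inter> v = {}} \<noteq> {w}"
proof
  assume eq: "{v \<in> \<Union>S. u \<inter> v = {}} = {w}"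
  have nbr: "\<exists>w'\<in>U. v \<inter> w' = {}" if "U \<in> S" "v \<in> U" for U v
    using component_neighbour[OF WV sym_kneser, of U v] that S(1) nontrivial
    by (auto simp: adj_kneser)
  have sub: "U \<subseteq> W" if "U \<in> S" for U
    using component_separated[OF WV, of U] that S(1) by (auto simp: separated_def)
  have uw: "u \<inter> w = {}" "w \<in> \<Union>S" using eq by auto
  have unique: "v = w" if "v \<in> \<Union>S" "u \<inter> v = {}" for v
    using eq that by (simp add: set_eq_iff) blast
  show False
  proof (cases "F \<subseteq> \<Union>S")
    case True
    then have "{v \<in> F. u \<inter> v = {}} = {w}" using eq F(3) by blast
    then show False using four_cycle_not_forced[OF F(1)] u F(2) by blast
  next
    case False
    have "separated (kneser n 2) W (\<Union>S)"
      using component_separated[OF WV] S(1) by (intro separated_Union) blast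
    then obtain Q where Q: "card Q = 4" "\<forall>v\<in>W. v \<subseteq> Q"
      using four_cycle_split[OF WV _ F uw(2) False] by blast
    obtain U1 where U1: "U1 \<in> S" "w \<in> U1" using uw(2) by blast
    have "\<not> S \<subseteq> {U1}" using S(2) card_mono[of "{U1}" S] by auto
    \<comment> \<open>A second selected component does not contain \<open>w\<close>, so
      \<open>u\<close> meets all its members. Two disjoint members confine \<open>u\<close> to the
      four points of \<open>Q\<close>.\<close>
    then obtain U2 where U2: "U2 \<in> S" "U2 \<noteq> U1" by blast
    then have "w \<notin> U2" using components_disjoint[OF WV sym_kneser] U1 S(1) by blast
    then have meet: "u \<inter> v \<noteq> {}" if "v \<in> U2" for v
      using unique[of v] U2(1) that by blast
    obtain e where e: "e \<in> U2" using component_nonempty[OF WV] U2(1) S(1) by blast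
    obtain e' where e': "e' \<in> U2" "e \<inter> e' = {}" using nbr[OF U2(1) e] by blast
    have "u \<subseteq> e \<union> e'"
      using kneser_pair_subset_Un[of u n e e'] u meet e e' by blast
    then have uQ: "u \<subseteq> Q" using Q(2) sub[OF U2(1)] e e'(1) by blast
    have wW: "w \<in> W" using F by blast
    obtain w' where w': "w' \<in> U1" "w \<inter> w' = {}" using nbr[OF U1] by blast
    have w'W: "w' \<in> W" using sub[OF U1(1)] w'(1) by blast
    have V: "u \<in> verts (kneser n 2)" "w \<in> verts (kneser n 2)" "w' \<in> verts (kneser n 2)"
      using u wW w'W WV by auto
    have finQ: "finite Q" using Q(1) by (metis card.infinite zero_neq_numeral)
    \<comment> \<open>Now \<open>u\<close> and \<open>w\<close> are complementary in
      \<open>Q\<close>, so the partner \<open>w'\<close> of \<open>w\<close> coincides with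
      \<open>u\<close>, although \<open>u\<close> is already coloured.\<close>
    have "card (u \<union> w) = 4" using V uw(1) by (simp add: card_Un_disjoint card_kneser_pair)
    then have "u \<union> w = Q"
      using Q finQ uQ wW by (intro card_subset_eq) auto
    then have "w' \<subseteq> u" using Q(2) w'W w'(2) by blast
    then have "w' = u" using V by (intro card_subset_eq) (auto simp: card_kneser_pair)
    then show False using w'W u by blast
  qed
qed

section \<open>Six uncoloured pairs on at most six points\<close>

text \<open>At most four points are available as leaves and at most one is used twice, so five
  leaves force \<open>n = 6\<close> and \<open>A \<union> B\<close> to be everything. This yields
  the spanning double star.\<close>

lemma ex_fort_in_double_star_6_ordered:
  assumes xy: "x \<in> {1..n}" "y \<in> {1..n}" "x \<noteq> y"
    and AB: "A \<subseteq> {1..n} - {x, y}" "B \<subseteq> {1..n} - {x, y}"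
    and W: "double_star x y A B \<subseteq> W"
    and n: "n \<le> 6" and large: "card A + card B \<ge> 5" and le: "card B \<le> card A"
    and inter: "card (A \<inter> B) \<le> 1"
  shows "\<exists>F\<subseteq>W. fort (kneser n 2) F"
proof -
  let ?R = "{1..n} - {x, y}"
  have R: "card ?R = n - 2" by (rule card_Diff_two[OF xy])
  have fin: "finite A" "finite B" using AB by (auto intro: finite_subset)
  have Un: "card A + card B = card (A \<union> B) + card (A \<inter> B)"
    using fin by (rule card_Un_Int)
  have "card (A \<union> B) \<le> n - 2" using card_mono[of ?R "A \<union> B"] AB R by simp
  then have n6: "n = 6" "card (A \<union> B) = card ?R" using Un n large inter R by auto
  then have eq: "A \<union> B = ?R" using AB by (intro card_subset_eq) auto
  have "card (A \<union> (B - A)) = card A + card (B - A)"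
    using fin by (intro card_Un_disjoint) auto
  then have "card (A \<union> B) = card A + card (B - A)" by simp
  \<comment> \<open>The larger leaf set \<open>A\<close> has at least three of the four
    points.\<close>
  then have BA: "card (B - A) \<le> 1" using n6 R large le by simp
  have "\<exists>b\<in>B. ?R \<subseteq> insert b A"
  proof (cases "B \<subseteq> A")
    case True
    then have "card (A \<inter> B) = card B" "card A = card ?R" using eq by (auto simp: Int_absorb1 Un_absorb2)
    then have "B \<noteq> {}" using large n6 R by auto
    then show ?thesis using True eq by blast
  next
    case False
    then obtain b where b: "b \<in> B" "b \<notin> A" by blast
    then have "{b} = B - A" using BA fin by (intro card_seteq) auto
    then show ?thesis using b eq by blast
  qed
  then obtain b where b: "b \<in> B" "?R \<subseteq> insert b A" by blast
  show ?thesis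
    by (rule ex_fort_in_spanning_double_star[OF xy _ _ b W]) (use n6 b(1) AB in auto)
qed

text \<open>Six edges on four points are all of them and contain a 4-cycle. In a double star two
  common leaves close a 4-cycle through both centres, while at most one common leaf leads to a
  fort.\<close>

lemma ex_fort_or_four_cycle:
  assumes n: "n \<le> 6" and WV: "W \<subseteq> verts (kneser n 2)" and large: "card W \<ge> 6"
  shows "\<exists>F\<subseteq>W. fort (kneser n 2) F \<or> F \<in> four_cycles n"
proof (cases "fort (kneser n 2) W")
  case False
  have "W \<noteq> {}" using large by auto
  from WV this False show ?thesis
  proof (cases rule: not_fort_cases)
    case (K4 Q)
    obtain a b c d where Q: "Q = {a, b, c, d}" "distinct [a, b, c, d]"
      using K4(1) by (auto simp: numeral_eq_Suc card_Suc_eq)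
    let ?P = "{v. v \<subseteq> Q \<and> card v = 2}"
    have "finite Q" using Q by simp
    then have fin: "finite ?P" and "card ?P = 6"
      using K4(1) by (simp_all add: n_subsets numeral_eq_Suc)
    moreover have "W \<subseteq> ?P" using K4(3) WV by (auto simp: verts_kneser)
    ultimately have "W = ?P" using large by (intro card_seteq) auto
    then have "{{a, b}, {b, c}, {c, d}, {d, a}} \<subseteq> W" using Q by auto
    moreover have "{{a, b}, {b, c}, {c, d}, {d, a}} \<in> four_cycles n"
      using Q K4(2) by (intro four_cycleI) auto
    ultimately show ?thesis by blast
  next
    case (double_star x y A B)
    show ?thesis
    proof (cases "card (A \<inter> B) \<ge> 2")
      case True
      then obtain T where "T \<subseteq> A \<inter> B" "card T = 2" by (rule obtain_subset_with_card_n)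
      then obtain a b where ab: "{a, b} \<subseteq> A \<inter> B" "a \<noteq> b" by (auto simp: card_2_iff)
      let ?F = "{{x, a}, {a, y}, {y, b}, {b, x}}"
      have "?F \<in> four_cycles n"
        by (rule four_cycleI) (use ab double_star(1-5) in auto)
      moreover have "?F \<subseteq> double_star x y A B"
        using ab by (auto simp: double_star_def insert_commute)
      ultimately show ?thesis using double_star(6) by blast
    next
      case False
      have sum: "card A + card B \<ge> 5" using large double_star(7) by simp
      have "\<exists>F\<subseteq>W. fort (kneser n 2) F"
      proof (cases "card B \<le> card A")
        case True
        then show ?thesis
          using False sum by (intro ex_fort_in_double_star_6_ordered[OF double_star(1-6) n]) auto
      next
        case 1: False
        have swapped: "B \<subseteq> {1..n} - {y, x}" "A \<subseteq> {1..n} - {y, x}" "double_star y x B A \<subseteq> W"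
          using double_star(4-6) by (auto simp: double_star_swap[of y x])
        show ?thesis
          by (rule ex_fort_in_double_star_6_ordered[OF double_star(2,1) double_star(3)[symmetric] swapped n])
            (use False 1 sum in \<open>auto simp: Int_commute\<close>)
      qed
      then show ?thesis by blast
    qed
  qed
qed blast

text \<open>Forts and 4-cycles are protected together: the oracle returns one isolated vertex if the
  selection has one, and the whole selection otherwise. The complement of the bought vertices then
  has at most five elements.\<close>

lemma Z_game_1_kneser_ge:
  assumes "n \<le> 6"
  shows "(n choose 2) - 5 \<le> Z_game 1 (kneser n 2)"
proof -
  let ?G = "kneser n 2"
  let ?\<F> = "Collect (fort ?G) \<union> four_cycles n"
  have plain: "{x \<in> W. (u, x) \<in> adj ?G} \<noteq> {w}"
    if F: "F \<in> ?\<F>" "F \<subseteq> W" and W: "W \<subseteq> verts ?G" and u: "u \<in> verts ?G - W" and w: "w \<in> F" for F W u w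
  proof
    assume eq: "{x \<in> W. (u, x) \<in> adj ?G} = {w}"
    have sep: "separated ?G W W" by (auto simp: separated_def)
    have "\<not> fort ?G F" using fort_not_forced[OF _ F(2) sep u w] eq by blast
    then have F4: "F \<in> four_cycles n" using F by blast
    have "{x \<in> W. u \<inter> x = {}} = {w}" using eq kneser_neighbours[OF W] u by auto
    then have "{x \<in> F. u \<inter> x = {}} = {w}" using F(2) w by blast
    moreover have "u \<in> verts ?G - F" using u F(2) by blast
    ultimately show False using four_cycle_not_forced[OF F4] by blast
  qed
  have oracle_answer: "\<exists>T\<subseteq>S. T \<noteq> {} \<and> (\<forall>F\<in>?\<F>. F \<subseteq> W \<longrightarrow>
      (\<forall>u\<in>verts ?G - W. \<forall>w\<in>F. {x \<in> \<Union>T. (u, x) \<in> adj ?G} \<noteq> {w}))"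
    if W: "W \<subseteq> verts ?G" and S: "S \<subseteq> components (induced ?G W)" "card S \<ge> 1 + 1" for W S
  proof -
    have S_ne: "S \<noteq> {}" using S(2) by auto
    \<comment> \<open>An isolated vertex lies on no uncoloured 4-cycle, as it would be adjacent to the opposite edge.\<close>
    define T where "T = (if \<exists>e. {e} \<in> S then {{SOME e. {e} \<in> S}} else S)"
    have T_cases: "(\<exists>e. {e} \<in> S \<and> T = {{e}}) \<or> ((\<forall>e. {e} \<notin> S) \<and> T = S)"
      unfolding T_def by (auto intro: someI)
    then have T: "T \<subseteq> S" "T \<noteq> {}" using S_ne by auto
    have sep: "separated ?G W (\<Union>T)"
      using component_separated[OF W] S(1) T(1) by (intro separated_Union) blast
    have "{x \<in> \<Union>T. (u, x) \<in> adj ?G} \<noteq> {w}"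
      if F: "F \<in> ?\<F>" "F \<subseteq> W" and u: "u \<in> verts ?G - W" and w: "w \<in> F" for F u w
    proof
      assume eq: "{x \<in> \<Union>T. (u, x) \<in> adj ?G} = {w}"
      have "\<not> fort ?G F" using fort_not_forced[OF _ F(2) sep u w] eq by blast
      then have F4: "F \<in> four_cycles n" using F by blast
      show False
        using T_cases
      proof (elim disjE exE conjE)
        fix e assume e: "{e} \<in> S" "T = {{e}}"
        then have "w = e" using eq by blast
        obtain w' where w': "w' \<in> F" "w \<inter> w' = {}" by (rule four_cycle_opposite[OF F4 w])
        then have "(w, w') \<in> adj ?G" using four_cycle_subset[OF F4] w by (auto simp: adj_kneser)
        then have "w' \<in> {e}" using sep e(2) w'(1) F(2) \<open>w = e\<close> unfolding separated_def by auto
        then have "w = {}" using w'(2) \<open>w = e\<close> by auto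
        then show False using four_cycle_subset[OF F4] w by (auto simp: verts_kneser)
      next
        assume "\<forall>e. {e} \<notin> S" "T = S"
        then have "{v \<in> \<Union>T. u \<inter> v = {}} \<noteq> {w}"
          using four_cycle_not_forced_by_components[OF W S(1) _ _ F4 F(2) w u] S(2) by auto
        moreover have "\<Union>T \<subseteq> verts ?G" using sep W by (auto simp: separated_def)
        ultimately show False using eq kneser_neighbours[of "\<Union>T" n 2 u] u by auto
      qed
    qed
    then show ?thesis using T by (intro exI[of _ T] conjI ballI impI)
  qed
  have ne: "F \<noteq> {} \<and> F \<subseteq> verts ?G" if "F \<in> ?\<F>" for F
    using that four_cycle_subset[of F n] by (auto simp: fort_def four_cycles_def)
  have "can_win 1 ?G (Z_game 1 ?G) {}" by (rule can_win_Z_game) simp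
  then have "\<exists>X. finite X \<and> card X \<le> Z_game 1 ?G \<and> (\<forall>F\<in>?\<F>. F \<inter> ({} \<union> X) \<noteq> {})"
    by (rule can_win_hitting_set[OF _ ne plain oracle_answer])
  then obtain X where X: "finite X" "card X \<le> Z_game 1 ?G" "\<forall>F\<in>?\<F>. F \<inter> X \<noteq> {}" by auto
  have "\<not> (\<exists>F\<subseteq>verts ?G - X. fort ?G F \<or> F \<in> four_cycles n)" using X(3) by blast
  then have "card (verts ?G - X) < 6"
    using ex_fort_or_four_cycle[OF assms, of "verts ?G - X"] by (meson Diff_subset not_le_imp_less)
  moreover have "card (verts ?G) - card X \<le> card (verts ?G - X)"
    using X(1) by (rule diff_card_le_card_Diff)
  ultimately show ?thesis
    using X(2) by (simp add: card_verts_kneser)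
qed

section \<open>Strategies for the player\<close>

lemma can_win_kneser_change:
  assumes W: "W \<subseteq> verts (kneser n r)" and u: "u \<in> verts (kneser n r)" "u \<notin> W"
    and seen: "{x \<in> W. u \<inter> x = {}} = {w}"
    and win: "can_win q (kneser n r) k (verts (kneser n r) - (W - {w}))"
  shows "can_win q (kneser n r) k (verts (kneser n r) - W)"
  by (rule can_win_change[OF W _ _ win]) (use u kneser_neighbours[OF W u(1)] seen in auto)

text \<open>Spare one leaf \<open>a\<close> and let \<open>u\<close> cover the at most two remaining
  leaves in \<open>D\<close>, filled up to a pair that avoids \<open>a\<close> and \<open>c\<close>.
  The bound \<open>n \<ge> 4\<close> leaves room for it.\<close>

lemma star_edge_seen:
  assumes "c \<in> {1..n}" "n \<ge> 4" "D \<subseteq> {1..n} - {c}" "D \<noteq> {}" "card D \<le> 3"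
  obtains u a where "u \<in> verts (kneser n 2)" "c \<notin> u" "a \<in> D"
    "{v \<in> (\<lambda>a. {c, a}) ` D. u \<inter> v = {}} = {{c, a}}"
proof -
  obtain a where a: "a \<in> D" using assms(4) by blast
  let ?R = "{1..n} - {c}"
  have "a \<in> ?R" using a assms(3) by blast
  then have "card (?R - {a}) = n - 2" using assms(1) by (simp add: card_Diff_singleton)
  moreover have "card (D - {a}) = card D - 1" using a by (rule card_Diff_singleton)
  ultimately have "card (D - {a}) \<le> 2" "2 \<le> card (?R - {a})" "D - {a} \<subseteq> ?R - {a}"
    using assms by auto
  then obtain u where u: "D - {a} \<subseteq> u" "u \<subseteq> ?R - {a}" "card u = 2"
    using exists_subset_between[of "D - {a}" 2 "?R - {a}"] by auto
  show thesis
  proof (rule that[OF _ _ a])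
    show "u \<in> verts (kneser n 2)" using u by (auto simp: verts_kneser)
    show "c \<notin> u" using u by blast
    show "{v \<in> (\<lambda>a. {c, a}) ` D. u \<inter> v = {}} = {{c, a}}" using u a by auto
  qed
qed

lemma isolated_component:
  assumes "W \<subseteq> verts G" "sym (adj G)" "v \<in> W" "\<forall>w\<in>W. (v, w) \<notin> adj G"
  shows "{v} \<in> components (induced G W)"
proof -
  obtain U where U: "U \<in> components (induced G W)" "v \<in> U"
    using obtain_component[OF assms(1,3)] .
  have "separated G W {v}" using assms(3,4) by (auto simp: separated_def)
  then have "U \<subseteq> {v}" by (rule component_subset_separated[OF assms(1,2) U(1) _ U(2)]) simp
  then have "U = {v}" using U(2) by blast
  then show ?thesis using U(1) by simp
qed

text \<open>The edges of a star pairwise meet, so each is a component by itself. Any nonempty answer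
  to a selection of three is a star with at most three leaves, in which an edge can be forced. Once
  fewer than three edges are left, the plain rule suffices.\<close>

lemma can_win_star:
  assumes c: "c \<in> {1..n}" and n: "n \<ge> 4" and "A \<subseteq> {1..n} - {c}"
  shows "can_win 2 (kneser n 2) 0 (verts (kneser n 2) - (\<lambda>a. {c, a}) ` A)"
  using assms(3)
proof (induction "card A" arbitrary: A rule: less_induct)
  case less
  let ?V = "verts (kneser n 2)" and ?star = "\<lambda>A. (\<lambda>a. {c, a}) ` A"
  have WV: "?star A \<subseteq> ?V" using less.prems c by (auto simp: pair_in_kneser)
  have fin: "finite A" using less.prems by (rule finite_subset) simp
  have IH: "can_win 2 (kneser n 2) 0 (?V - (?star A - {{c, a}}))" if "a \<in> A" for a
  proof -
    have "?star A - {{c, a}} = ?star (A - {a})" by (auto simp: doubleton_eq_iff)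
    moreover have "card (A - {a}) < card A" using that fin by (rule card_Diff1_less[rotated])
    ultimately show ?thesis using less.hyps[of "A - {a}"] less.prems by auto
  qed
  consider "A = {}" | "A \<noteq> {}" "card A < 3" | "card A \<ge> 3" by linarith
  then show ?case
  proof cases
    case 1
    then show ?thesis by (intro can_win.finished) simp
  next
    case 2
    obtain u a where u: "u \<in> ?V" "c \<notin> u" "a \<in> A" "{v \<in> ?star A. u \<inter> v = {}} = {{c, a}}"
      using star_edge_seen[OF c n less.prems 2(1)] 2(2) by auto
    show ?thesis
      by (rule can_win_kneser_change[OF WV u(1) _ u(4) IH[OF u(3)]]) (use u(2) in auto)
  next
    case 3
    then obtain D0 where D0: "D0 \<subseteq> A" "card D0 = 3" by (rule obtain_subset_with_card_n)
    let ?S = "(\<lambda>a. {{c, a}}) ` D0"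
    show ?thesis
    proof (rule can_win_oracle[OF WV])
      show "?S \<subseteq> components (induced (kneser n 2) (?star A))"
      proof (rule image_subsetI)
        fix a assume "a \<in> D0"
        then show "{{c, a}} \<in> components (induced (kneser n 2) (?star A))"
          using D0(1) by (intro isolated_component[OF WV sym_kneser]) (auto simp: adj_kneser)
      qed
      have "inj_on (\<lambda>a. {{c, a}}) D0" by (auto simp: inj_on_def doubleton_eq_iff)
      then show "2 + 1 \<le> card ?S" using D0(2) by (simp add: card_image)
      fix T assume T: "T \<subseteq> ?S" "T \<noteq> {}"
      obtain D where D: "D \<subseteq> D0" "T = (\<lambda>a. {{c, a}}) ` D"
        by (rule subset_imageE[OF T(1)])
      have D_ne: "D \<noteq> {}" using T(2) D(2) by auto
      have finD0: "finite D0" using D0(1) fin by (rule finite_subset)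
      have D_card: "card D \<le> 3" using card_mono[OF finD0 D(1)] D0(2) by simp
      have DR: "D \<subseteq> {1..n} - {c}" using D(1) D0(1) less.prems by blast
      obtain u a where u: "u \<in> ?V" "c \<notin> u" "a \<in> D" "{v \<in> ?star D. u \<inter> v = {}} = {{c, a}}"
        by (rule star_edge_seen[OF c n DR D_ne D_card])
      have "\<Union>T = ?star D" using D(2) by auto
      moreover have "?star D \<subseteq> ?V" using D(1) D0(1) WV by blast
      ultimately have "{v \<in> \<Union>T. (u, v) \<in> adj (kneser n 2)} = {{c, a}}"
        using kneser_neighbours[of "?star D" n 2 u] u(1,4) by simp
      moreover have "u \<in> ?V - ?star A" using u(1,2) by auto
      moreover have "a \<in> A" using u(3) D(1) D0(1) by blast
      ultimately show "\<exists>u\<in>?V - ?star A. \<exists>w. {v \<in> \<Union>T. (u, v) \<in> adj (kneser n 2)} = {w} \<and>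
          can_win 2 (kneser n 2) 0 (?V - (?star A - {w}))"
        using IH by (intro bexI[of _ u] exI[of _ "{c, a}"] conjI)
    qed
  qed
qed

lemma choose_two_pred: "n \<ge> 1 \<Longrightarrow> n choose 2 = (n - 1) + ((n - 1) choose 2)"
  by (cases n) (simp_all add: numeral_2_eq_2)

text \<open>The full star at \<open>n\<close> is left uncoloured, which saves \<open>n - 1\<close>
  tokens for \<open>q = 2\<close> and hence for smaller \<open>q\<close>.\<close>

lemma Z_game_kneser_le:
  assumes "n \<ge> 4" "q \<le> 2"
  shows "Z_game q (kneser n 2) \<le> (n - 1) choose 2"
proof -
  let ?W = "(\<lambda>a. {n, a}) ` ({1..n} - {n})"
  have c: "n \<in> {1..n}" using assms by simp
  have "?W \<subseteq> verts (kneser n 2)" using assms(1) by (auto simp: pair_in_kneser)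
  then have "Z_game 2 (kneser n 2) \<le> card (verts (kneser n 2)) - card ?W"
    by (intro Z_game_le can_win_star[OF c assms(1)]) auto
  moreover have "card ?W = n - 1"
    using c by (subst card_image) (auto simp: inj_on_def doubleton_eq_iff)
  moreover note choose_two_pred[of n]
  moreover have "Z_game q (kneser n 2) \<le> Z_game 2 (kneser n 2)"
    using assms(2) by (intro Z_game_mono) auto
  ultimately show ?thesis using assms(1) by (simp add: card_verts_kneser)
qed

text \<open>Among pairs in four points only complementary ones are adjacent, so a component consists
  of some \<open>e\<close> and at most its complement. With \<open>q = 0\<close> it may be announced
  alone, and the fifth point helps to attack it.\<close>

lemma can_win_K4:
  assumes n: "n \<ge> 5" and "W \<subseteq> {v. v \<subseteq> {1..4} \<and> card v = 2}"
  shows "can_win 0 (kneser n 2) 0 (verts (kneser n 2) - W)"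
  using assms(2)
proof (induction "card W" arbitrary: W rule: less_induct)
  case less
  let ?V = "verts (kneser n 2)" and ?Q = "{1..4::nat}"
  have WQ: "v \<subseteq> ?Q" "card v = 2" if "v \<in> W" for v using that less.prems by auto
  have WV: "W \<subseteq> ?V"
  proof
    fix v assume v: "v \<in> W"
    have "?Q \<subseteq> {1..n}" using n by auto
    then have "v \<subseteq> {1..n}" using WQ(1)[OF v] by (rule subset_trans[rotated])
    then show "v \<in> ?V" using WQ(2)[OF v] by (simp add: verts_kneser)
  qed
  show ?case
  proof (cases "W = {}")
    case True
    then show ?thesis by (intro can_win.finished) simp
  next
    case False
    then obtain e where e: "e \<in> W" by blast
    obtain U where U: "U \<in> components (induced (kneser n 2) W)" "e \<in> U"
      using obtain_component[OF WV e] .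
    have compl: "d = ?Q - v" if "v \<in> W" "d \<in> W" "v \<inter> d = {}" for v d
    proof (rule card_subset_eq)
      show "d \<subseteq> ?Q - v" using that WQ(1) by blast
      have "card (?Q - v) = card ?Q - card v"
        using WQ[OF that(1)] by (intro card_Diff_subset) (auto intro: finite_subset)
      then show "card d = card (?Q - v)" using WQ(2) that by simp
    qed simp
    have "separated (kneser n 2) W {v \<in> W. v = e \<or> v = ?Q - e}"
      unfolding separated_def adj_kneser using compl e WQ(1) by blast
    then have "U \<subseteq> {v \<in> W. v = e \<or> v = ?Q - e}"
      by (rule component_subset_separated[OF WV sym_kneser U(1) _ U(2)]) (use e in simp)
    then have UW: "U \<subseteq> W" and U_sub: "U \<subseteq> {e, ?Q - e}" by auto
    have "\<not> ?Q \<subseteq> e"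
    proof
      assume "?Q \<subseteq> e"
      then have "e = ?Q" using WQ(1)[OF e] by blast
      then show False using WQ(2)[OF e] by simp
    qed
    \<comment> \<open>As \<open>z\<close> lies in the complement of \<open>e\<close>, the pair
      \<open>{5, z}\<close> misses \<open>e\<close> but meets the only other possible member of
      \<open>U\<close>.\<close>
    then obtain z where z: "z \<in> ?Q" "z \<notin> e" by blast
    have u: "{5, z} \<in> ?V - W"
    proof
      show "{5, z} \<in> ?V" using z n by (auto simp: pair_in_kneser)
      show "{5, z} \<notin> W" using WQ(1)[of "{5, z}"] by auto
    qed
    have "5 \<notin> e" using WQ(1)[OF e] by auto
    then have "{v \<in> U. {5, z} \<inter> v = {}} = {e}" using U_sub U(2) z by auto
    then have seen: "{v \<in> U. ({5, z}, v) \<in> adj (kneser n 2)} = {e}"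
      using kneser_neighbours[of U n 2 "{5, z}"] UW WV u by auto
    have finW: "finite W" using WV by (rule finite_subset) simp
    have win: "can_win 0 (kneser n 2) 0 (?V - (W - {e}))"
      using less.hyps[of "W - {e}"] card_Diff1_less[OF finW e] less.prems by blast
    show ?thesis
    proof (rule can_win_oracle[OF WV, of "{U}"])
      show "{U} \<subseteq> components (induced (kneser n 2) W)" using U(1) by simp
      fix T assume "T \<subseteq> {U}" "T \<noteq> {}"
      then have "T = {U}" by blast
      then show "\<exists>u\<in>?V - W. \<exists>w. {v \<in> \<Union>T. (u, v) \<in> adj (kneser n 2)} = {w} \<and>
          can_win 0 (kneser n 2) 0 (?V - (W - {w}))"
        using seen win by (intro bexI[OF _ u] exI[of _ e]) simp
    qed simp
  qed
qed

lemma Z_game_0_kneser_le: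
  assumes "n \<ge> 5"
  shows "Z_game 0 (kneser n 2) \<le> (n choose 2) - 6"
proof -
  let ?W = "{v. v \<subseteq> {1..4::nat} \<and> card v = 2}"
  have "{1..4} \<subseteq> {1..n}" using assms by auto
  then have "?W \<subseteq> verts (kneser n 2)" unfolding verts_kneser by blast
  then have "Z_game 0 (kneser n 2) \<le> card (verts (kneser n 2)) - card ?W"
    by (intro Z_game_le can_win_K4[OF assms]) auto
  moreover have "card ?W = 6" by (simp add: n_subsets numeral_eq_Suc)
  ultimately show ?thesis by (simp add: card_verts_kneser)
qed

lemma can_win_kneser_insert:
  assumes win: "can_win q (kneser n r) k (verts (kneser n r) - W)"
    and W: "insert w W \<subseteq> verts (kneser n r)" "w \<notin> W"
    and u: "u \<in> verts (kneser n r)" "u \<notin> insert w W" "u \<inter> w = {}" "\<forall>x\<in>W. u \<inter> x \<noteq> {}"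
  shows "can_win q (kneser n r) k (verts (kneser n r) - insert w W)"
proof (rule can_win_kneser_change[OF W(1) u(1,2)])
  show "{x \<in> insert w W. u \<inter> x = {}} = {w}" using u(3,4) by auto
  show "can_win q (kneser n r) k (verts (kneser n r) - (insert w W - {w}))"
    using win W(2) by simp
qed

text \<open>Each chord of the 5-cycle on 1, 2, 3, 4, 5 is disjoint from exactly one side, so the
  plain rule is enough for every \<open>q\<close>. The derivation is built from the end of the play:
  the sides get coloured in the order in which the set lists them.\<close>

lemma can_win_C5:
  "can_win q (kneser 5 2) 0 (verts (kneser 5 2) - {{4, 5}, {2, 3}, {5, 1}, {1, 2}, {3, 4}})"
proof -
  have "can_win q (kneser 5 2) 0 (verts (kneser 5 2) - {})"
    by (rule can_win.finished) simp
  then have "can_win q (kneser 5 2) 0 (verts (kneser 5 2) - {{3, 4}})"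
    by (rule can_win_kneser_insert[where u = "{1, 2}"])
      (simp_all add: pair_in_kneser doubleton_eq_iff)
  then have "can_win q (kneser 5 2) 0 (verts (kneser 5 2) - {{1, 2}, {3, 4}})"
    by (rule can_win_kneser_insert[where u = "{3, 5}"])
      (simp_all add: pair_in_kneser doubleton_eq_iff)
  then have "can_win q (kneser 5 2) 0 (verts (kneser 5 2) - {{5, 1}, {1, 2}, {3, 4}})"
    by (rule can_win_kneser_insert[where u = "{2, 4}"])
      (simp_all add: pair_in_kneser doubleton_eq_iff)
  then have "can_win q (kneser 5 2) 0 (verts (kneser 5 2) - {{2, 3}, {5, 1}, {1, 2}, {3, 4}})"
    by (rule can_win_kneser_insert[where u = "{1, 4}"])
      (simp_all add: pair_in_kneser doubleton_eq_iff)
  then show ?thesis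
    by (rule can_win_kneser_insert[where u = "{1, 3}"])
      (simp_all add: pair_in_kneser doubleton_eq_iff)
qed

lemma Z_game_kneser_5_le: "Z_game q (kneser 5 2) \<le> 5"
proof -
  let ?W = "{{4, 5}, {2, 3}, {5, 1}, {1, 2}, {3, 4}} :: nat set set"
  have sub: "?W \<subseteq> verts (kneser 5 2)" by (simp add: pair_in_kneser)
  have "Z_game q (kneser 5 2) \<le> card (verts (kneser 5 2)) - card ?W"
    by (rule Z_game_le[OF finite_verts_kneser can_win_C5 sub])
  moreover have "card ?W = 5" by (simp add: doubleton_eq_iff)
  moreover have "card (verts (kneser 5 2)) = 10"
    by (simp add: card_verts_kneser numeral_eq_Suc)
  ultimately show ?thesis by simp
qed

theorem theorem4p21:
  fixes n :: nat
  assumes "n \<ge> 5"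
  shows "(n \<in> {5, 6, 7} \<longrightarrow> Z_game 0 (kneser n 2) = (n choose 2) - 6) \<and>
         (n \<in> {5, 6} \<longrightarrow> Z_game 1 (kneser n 2) = (n choose 2) - 5) \<and>
         Z_game 1 (kneser 7 2) = 15 \<and>
         (n \<ge> 8 \<longrightarrow> (\<forall>q \<in> {0, 1, 2}.
            Z_game q (kneser n 2) \<in> {((n - 1) choose 2) - 1, (n - 1) choose 2}))"
proof -
  have choose: "5 choose 2 = (10::nat)" "6 choose 2 = (15::nat)" "7 choose 2 = (21::nat)"
    by (simp_all add: numeral_eq_Suc)
  have "Z_game 0 (kneser n 2) = (n choose 2) - 6" if "n \<in> {5, 6, 7}"
    using that Z_game_kneser_ge[of n 0] Z_game_0_kneser_le[OF assms] by auto
  moreover have "Z_game 1 (kneser n 2) = (n choose 2) - 5" if n: "n \<in> {5, 6}"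
  proof (rule antisym)
    show "(n choose 2) - 5 \<le> Z_game 1 (kneser n 2)" using n by (intro Z_game_1_kneser_ge) auto
    show "Z_game 1 (kneser n 2) \<le> (n choose 2) - 5"
      \<comment> \<open>For \<open>n = 5\<close> the 5-cycle gives 10 - 5. For \<open>n = 6\<close>
        the star gives 5 choose 2, which is 15 - 5.\<close>
      using n Z_game_kneser_5_le[of 1] Z_game_kneser_le[of 6 1] choose by auto
  qed
  moreover have "Z_game 1 (kneser 7 2) = 15"
    using Z_game_kneser_ge[of 7 1] Z_game_kneser_le[of 7 1] choose by simp
  moreover have "Z_game q (kneser n 2) \<in> {((n - 1) choose 2) - 1, (n - 1) choose 2}"
    if "n \<ge> 8" "q \<in> {0, 1, 2}" for q
  proof -
    have "Z_game q (kneser n 2) \<le> (n - 1) choose 2" using that by (intro Z_game_kneser_le) auto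
    \<comment> \<open>Subtracting \<open>n\<close> from \<open>n choose 2\<close> removes the star
      at one point and one more edge.\<close>
    moreover have "((n - 1) choose 2) - 1 \<le> Z_game q (kneser n 2)"
      using Z_game_kneser_ge[of n q] that(1) choose_two_pred[of n] by simp
    ultimately show ?thesis by auto
  qed
  ultimately show ?thesis by blast
qed

end
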